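(* For $0\le t<1$ write $\widetilde\nabla_t=\widetilde\nabla_0+\omega_t$, where $\widetilde\nabla_t\eta=\widetilde\Psi^\dag\mathrm d(\widetilde\Psi\eta)$ is the Grassmannian connection on $L_1\oplus L_{-1}$ and $\widetilde\nabla_0=\nabla_1\oplus\nabla_{-1}$. Then the matrix of one-forms $\omega_t$ is $$\omega_t=\begin{pmatrix}A^*-A&\Phi\\-\Phi^*&B-B^*\end{pmatrix}$$ with, for $x:=p_{11}$, $$A^*=q\sqrt{1-t^2x}\;\partial\frac1{\sqrt{1-t^2x}},\qquad B=q^{-1}\sqrt{1-t^2q^4x}\;\bar\partial\frac1{\sqrt{1-t^2q^4x}},$$ $$\Phi=q^{-\frac12}t\,\frac1{\sqrt{1-t^2x}}\,\phi\,\frac1{\sqrt{1-t^2q^4x}},$$ where $\phi=q^{\frac12}\sum_{j=1}^3\bigl\{z_j(\partial p_{j2})z_3-qz_j(\partial p_{j3})z_2\bigr\}$.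
   Context: **Algebras.** Fix $0<q<1$. $\mathcal U=\mathcal U_q(\mathfrak{su}(3))$ is the Hopf $*$-algebra generated by $K_i^{\pm1},E_i,F_i$ ($i=1,2$), with $K_i=K_i^*$, $F_i=E_i^*$, relations $[K_i,K_j]=0$, $[E_i,F_i]=\frac{K_i^2-K_i^{-2}}{q-q^{-1}}$, $[E_i,F_j]=0$ ($i\ne j$), $K_iE_iK_i^{-1}=qE_i$, $K_iE_jK_i^{-1}=q^{-1/2}E_j$ ($i\neq j$), $[E_i,[E_j,E_i]_q]_q=0$ with $[a,b]_q=ab-q^{-1}ba$; coproduct $\Delta(K_i)=K_i\otimes K_i$, $\Delta(E_i)=E_i\otimes K_i+K_i^{-1}\otimes E_i$, $\Delta(F_i)=F_i\otimes K_i+K_i^{-1}\otimes F_i$; counit $\epsilon(K_i)=1$, $\epsilon(E_i)=\epsilon(F_i)=0$; antipode $S(K_i)=K_i^{-1}$, $S(E_i)=-qE_i$, $S(F_i)=-q^{-1}F_i$. $\mathcal A(\mathrm{SU}_q(3))$ is the $*$-algebra generated by $u^i_j$ ($i,j=1,2,3$) with $u^i_ku^j_k=qu^j_ku^i_k$, $u^k_iu^k_j=qu^k_ju^k_i$ for $i<j$; $[u^i_l,u^j_k]=0$, $[u^i_k,u^j_l]=(q-q^{-1})u^i_lu^j_k$ for $i<j$, $k<l$; $\sum_{\pi\in S_3}(-q)^{l(\pi)}u^1_{\pi(1)}u^2_{\pi(2)}u^3_{\pi(3)}=1$ ($l(\pi)$ the number of inversions); and $(u^i_j)^*=(-q)^{j-i}(u^{k_1}_{l_1}u^{k_2}_{l_2}-qu^{k_1}_{l_2}u^{k_2}_{l_1})$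 with $\{k_1<k_2\}=\{1,2,3\}\smallsetminus\{i\}$, $\{l_1<l_2\}=\{1,2,3\}\smallsetminus\{j\}$. It carries the right action $\triangleleft$ of $\mathcal U$ with $(ab)\triangleleft x=(a\triangleleft x_{(1)})(b\triangleleft x_{(2)})$, $a^*\triangleleft x=(a\triangleleft S(x)^* )^*$, $u^j_k\triangleleft K_i=q^{\frac12(\delta_{i+1,j}-\delta_{i,j})}u^j_k$, $u^j_k\triangleleft E_i=\delta_{i+1,j}u^i_k$, $u^j_k\triangleleft F_i=\delta_{i,j}u^{i+1}_k$. $\mathcal A=\mathcal A(\mathbb{C}\mathrm{P}^2_q)$ is the $*$-algebra of elements invariant ($a\triangleleft h=\epsilon(h)a$) under the Hopf subalgebra generated by $K_1^{\pm1},E_1,F_1,(K_1K_2^2)^{\pm1}$; it is generated by $p_{ij}=z_i^*z_j$, where $z_i:=u^3_i$. For $N\in\mathbb Z$, the line bundle $L_N$ is the $\mathcal A$-bimodule of $a\in\mathcal A(\mathrm{SU}_q(3))$ with $a\triangleleft K_1=a$, $a\triangleleft E_1=a\triangleleft F_1=0$, $a\triangleleft K_1K_2^2=q^Na$. **One-forms.** One-forms of type $(1,0)$ and $(0,1)$ (possibly with coefficients in line bundles) are represented by columns $(v_1,v_2)^t$ with entries in $\mathcal A(\mathrm{SU}_q(3))$, multiplied componentwise from left and right by elements of $\mathcal A(\mathrm{SU}_q(3))$. The differential is $\mathrm d=\partial+\bar\partial$ with, for $a\in\mathcal A$, $$\partial a=\mathrm i\,q^{-\frac32}(a\triangleleft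 E_2,\ a\triangleleft E_2E_1)^t\ \text{(type }(1,0)),\qquad \bar\partial a=\mathrm i\,(a\triangleleft F_2F_1,\ a\triangleleft F_2)^t\ \text{(type }(0,1)).$$ The involution on one-forms is antilinear, exchanges types $(1,0)$ and $(0,1)$, and satisfies $(a\omega b)^*=b^*\omega^*a^*$ and the reality condition $\bar\partial a=(\partial a^* )^*$, i.e. $\mathrm d(a^* )=(\mathrm da)^*$; in components, $(v_1,v_2)^t\mapsto(-q^{-\frac12}v_2^*,q^{\frac12}v_1^* )^t$ on type $(1,0)$ and $(v_1,v_2)^t\mapsto(q^{-\frac12}v_2^*,-q^{\frac12}v_1^* )^t$ on type $(0,1)$. **Connections.** With $\Psi_1=(z_1^*,z_2^*,z_3^* )^t$ and $\Psi_{-1}=(q^2z_1,qz_2,z_3)^t$ (which satisfy $\Psi_{\pm1}^\dag\Psi_{\pm1}=1$), the monopole connections are $\nabla_{\pm1}\eta=\Psi_{\pm1}^\dag\mathrm d(\Psi_{\pm1}\eta)$ for $\eta\in L_{\pm1}$. Let $t=\sin2\theta$ with $0\le\theta<\pi/4$ and $$\psi=(\cos2\theta\,z_1^*,\ \cos\theta\,z_2^*,\ \cos\theta\,z_3^*,\ 0,\ \sin\theta\,z_3^*,\ \sin\theta\,z_2^* )^t,$$ $$\varphi=(0,\ -\sin\theta\,z_3,\ q\sin\theta\,z_2,\ q^2\cos2\theta\,z_1,\ q\cos\theta\,z_2,\ -\cos\theta\,z_3)^t .$$ These satisfy $\psi^\dag\varphi=0$, $\psi^\dag\psi=1-t^2p_{11}$,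 $\varphi^\dag\varphi=1-t^2q^4p_{11}$. The $6\times2$ matrix $\widetilde\Psi$ has first column $\psi\,(1-t^2p_{11})^{-1/2}$ and second column $\varphi\,(1-t^2q^4p_{11})^{-1/2}$, so $\widetilde\Psi^\dag\widetilde\Psi=1_2$. Elements $\eta\in L_1\oplus L_{-1}$ are columns $(\eta_1,\eta_2)^t$, and $\omega_t$ acts by left matrix multiplication. Throughout, $\mathcal A$ and all modules are understood to be enlarged (keeping the same symbols) by adjoining the elements $(1-t^2q^kp_{11})^{\pm1/2}$, $k\ge0$, and their powers, defined as convergent power series in $p_{11}$ in the universal $C^*$-algebra (where $\|p_{11}\|\le1$), with $\partial,\bar\partial$ applied term by term. *)

theory Defs
  imports "HOL-Analysis.Analysis" "HOL-Library.Poly_Mapping"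
begin

section \<open>C*-algebras\<close>

class scaleC =
  fixes scaleC :: "complex \<Rightarrow> 'a \<Rightarrow> 'a"

class cstar_algebra = real_normed_algebra_1 + complete_space + scaleC +
  fixes adj :: "'a \<Rightarrow> 'a"
  assumes scaleC_add_right: "scaleC c (a + b) = scaleC c a + scaleC c b"
    and scaleC_add_left: "scaleC (c + d) a = scaleC c a + scaleC d a"
    and scaleC_scaleC: "scaleC c (scaleC d a) = scaleC (c * d) a"
    and scaleC_of_real: "scaleC (complex_of_real r) a = r *\<^sub>R a"
    and mult_scaleC_left: "scaleC c a * b = scaleC c (a * b)"
    and mult_scaleC_right: "a * scaleC c b = scaleC c (a * b)"
    and norm_scaleC: "norm (scaleC c a) = cmod c * norm a"
    and adj_add: "adj (a + b) = adj a + adj b"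
    and adj_scaleC: "adj (scaleC c a) = scaleC (cnj c) (adj a)"
    and adj_mult: "adj (a * b) = adj b * adj a"
    and adj_adj: "adj (adj a) = a"
    and cstar_identity: "norm (adj a * a) = (norm a)\<^sup>2"


section \<open>Free complex algebras\<close>

datatype 'g fmon = Word (letters: "'g list")

instantiation fmon :: (type) monoid_add
begin
definition "0 = Word []"
definition "v + w = Word (letters v @ letters w)"
instance by standard (auto simp: zero_fmon_def plus_fmon_def)
end

text \<open>The free unital algebra on \<open>'g\<close> is the monoid algebra of the free monoid; its
  product is the convolution product of finitely supported functions.\<close>

type_synonym 'g falg = "'g fmon \<Rightarrow>\<^sub>0 complex"

definition fa_const :: "complex \<Rightarrow> 'g falg" where
  "fa_const c = Poly_Mapping.single 0 c"

definition fa_gen :: "'g \<Rightarrow> 'g falg" where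
  "fa_gen g = Poly_Mapping.single (Word [g]) 1"

text \<open>The algebra homomorphism into an algebra with scalar multiplication \<open>s\<close> which
  extends a map \<open>\<gamma>\<close> on generators.\<close>

definition fa_eval :: "(complex \<Rightarrow> 'b \<Rightarrow> 'b) \<Rightarrow> ('g \<Rightarrow> 'b) \<Rightarrow> 'g falg \<Rightarrow> 'b::ring_1" where
  "fa_eval s \<gamma> f =
     (\<Sum>w\<in>Poly_Mapping.keys f. s (Poly_Mapping.lookup f w) (prod_list (map \<gamma> (letters w))))"

text \<open>The antilinear antimultiplicative involution extending an involution \<open>\<tau>\<close> of the generators.\<close>

definition fa_star :: "('g \<Rightarrow> 'g) \<Rightarrow> 'g falg \<Rightarrow> 'g falg" where
  "fa_star \<tau> f =
     (\<Sum>w\<in>Poly_Mapping.keys f.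
        Poly_Mapping.single (Word (rev (map \<tau> (letters w)))) (cnj (Poly_Mapping.lookup f w)))"

text \<open>The two-sided *-ideal generated by \<open>R\<close>: the *-algebra with these generators and
  relations \<open>R\<close> is the quotient by it.\<close>

inductive_set fa_star_ideal :: "('g \<Rightarrow> 'g) \<Rightarrow> 'g falg set \<Rightarrow> 'g falg set"
  for \<tau> :: "'g \<Rightarrow> 'g" and R :: "'g falg set" where
  zero: "0 \<in> fa_star_ideal \<tau> R"
| rel: "r \<in> R \<Longrightarrow> r \<in> fa_star_ideal \<tau> R"
| add: "f \<in> fa_star_ideal \<tau> R \<Longrightarrow> g \<in> fa_star_ideal \<tau> R \<Longrightarrow> f + g \<in> fa_star_ideal \<tau> R"
| mult_left: "f \<in> fa_star_ideal \<tau> R \<Longrightarrow> h * f \<in> fa_star_ideal \<tau> R"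
| mult_right: "f \<in> fa_star_ideal \<tau> R \<Longrightarrow> f * h \<in> fa_star_ideal \<tau> R"
| star: "f \<in> fa_star_ideal \<tau> R \<Longrightarrow> fa_star \<tau> f \<in> fa_star_ideal \<tau> R"


section \<open>Index sets\<close>

datatype ind = I1 | I2 | I3

fun ix :: "ind \<Rightarrow> nat" where
  "ix I1 = 1" | "ix I2 = 2" | "ix I3 = 3"

instance ind :: finite
proof
  have "(UNIV :: ind set) = {I1, I2, I3}"
    using ind.exhaust by blast
  then show "finite (UNIV :: ind set)"
    by (metis finite.emptyI finite.insertI)
qed

datatype node = N1 | N2

text \<open>The node \<open>i\<close> of the Dynkin diagram, read as the matrix index \<open>i\<close> resp. \<open>i + 1\<close>.\<close>

fun lo :: "node \<Rightarrow> ind" where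
  "lo N1 = I1" | "lo N2 = I2"

fun up :: "node \<Rightarrow> ind" where
  "up N1 = I2" | "up N2 = I3"


section \<open>The Hopf *-algebra \<open>U\<^sub>q(su(3))\<close>\<close>

text \<open>Elements are represented in the free algebra on \<open>K\<^sub>i, K\<^sub>i\<^sup>-\<^sup>1, E\<^sub>i, F\<^sub>i\<close>; the algebra
  itself is the quotient by \<open>Uq_ideal\<close>.\<close>

datatype ugen = UK node | UKinv node | UE node | UF node

fun ugen_star :: "ugen \<Rightarrow> ugen" where
  "ugen_star (UK i) = UK i"
| "ugen_star (UKinv i) = UKinv i"
| "ugen_star (UE i) = UF i"
| "ugen_star (UF i) = UE i"

abbreviation "gK i \<equiv> fa_gen (UK i)"
abbreviation "gKi i \<equiv> fa_gen (UKinv i)"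
abbreviation "gE i \<equiv> fa_gen (UE i)"
abbreviation "gF i \<equiv> fa_gen (UF i)"

definition q_bracket :: "real \<Rightarrow> 'g falg \<Rightarrow> 'g falg \<Rightarrow> 'g falg" where
  "q_bracket q a b = a * b - fa_const (1 / q) * b * a"

definition Uq_rels :: "real \<Rightarrow> ugen falg set" where
  "Uq_rels q =
     {gK i * gKi i - 1 | i. True} \<union> {gKi i * gK i - 1 | i. True}
   \<union> {gK i * gK j - gK j * gK i | i j. True}
   \<union> {gE i * gF i - gF i * gE i
        - fa_const (1 / (q - 1 / q)) * (gK i * gK i - gKi i * gKi i) | i. True}
   \<union> {gE i * gF j - gF j * gE i | i j. i \<noteq> j}
   \<union> {gK i * gE i * gKi i - fa_const q * gE i | i. True}
   \<union> {gK i * gE j * gKi i - fa_const (q powr (-1/2)) * gE j | i j. i \<noteq> j}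
   \<union> {q_bracket q (gE i) (q_bracket q (gE j) (gE i)) | i j. i \<noteq> j}"

definition Uq_ideal :: "real \<Rightarrow> ugen falg set" where
  "Uq_ideal q = fa_star_ideal ugen_star (Uq_rels q)"

text \<open>The monoid algebra of \<open>ugen fmon \<times> ugen fmon\<close> is the tensor square of the free algebra.\<close>

fun coproduct_gen :: "ugen \<Rightarrow> (ugen fmon \<times> ugen fmon) \<Rightarrow>\<^sub>0 complex" where
  "coproduct_gen (UK i) = Poly_Mapping.single (Word [UK i], Word [UK i]) 1"
| "coproduct_gen (UKinv i) = Poly_Mapping.single (Word [UKinv i], Word [UKinv i]) 1"
| "coproduct_gen (UE i) = Poly_Mapping.single (Word [UE i], Word [UK i]) 1
                       + Poly_Mapping.single (Word [UKinv i], Word [UE i]) 1"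
| "coproduct_gen (UF i) = Poly_Mapping.single (Word [UF i], Word [UK i]) 1
                       + Poly_Mapping.single (Word [UKinv i], Word [UF i]) 1"

definition coproduct :: "ugen falg \<Rightarrow> (ugen fmon \<times> ugen fmon) \<Rightarrow>\<^sub>0 complex" where
  "coproduct = fa_eval (\<lambda>c f. Poly_Mapping.single 0 c * f) coproduct_gen"

fun antipode_gen :: "real \<Rightarrow> ugen \<Rightarrow> ugen falg" where
  "antipode_gen q (UK i) = gKi i"
| "antipode_gen q (UKinv i) = gK i"
| "antipode_gen q (UE i) = - (fa_const q * gE i)"
| "antipode_gen q (UF i) = - (fa_const (1 / q) * gF i)"

definition antipode :: "real \<Rightarrow> ugen falg \<Rightarrow> ugen falg" where
  "antipode q x =
     (\<Sum>w\<in>Poly_Mapping.keys x. fa_const (Poly_Mapping.lookup x w)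
        * prod_list (map (antipode_gen q) (rev (letters w))))"


section \<open>The *-algebra \<open>A(SU\<^sub>q(3))\<close> and its universal C*-algebra\<close>

datatype agen = AU ind ind | AUstar ind ind

fun agen_star :: "agen \<Rightarrow> agen" where
  "agen_star (AU i j) = AUstar i j"
| "agen_star (AUstar i j) = AU i j"

abbreviation "gu i j \<equiv> fa_gen (AU i j)"

definition inversions :: "(ind \<Rightarrow> ind) \<Rightarrow> nat" where
  "inversions \<pi> = card {(i, j). ix i < ix j \<and> ix (\<pi> j) < ix (\<pi> i)}"

definition SUq3_rels :: "real \<Rightarrow> agen falg set" where
  "SUq3_rels q =
     {gu i k * gu j k - fa_const q * gu j k * gu i k | i j k. ix i < ix j}
   \<union> {gu k i * gu k j - fa_const q * gu k j * gu k i | i j k. ix i < ix j}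
   \<union> {gu i l * gu j k - gu j k * gu i l | i j k l. ix i < ix j \<and> ix k < ix l}
   \<union> {gu i k * gu j l - gu j l * gu i k - fa_const (q - 1 / q) * gu i l * gu j k
        | i j k l. ix i < ix j \<and> ix k < ix l}
   \<union> {(\<Sum>\<pi> | bij \<pi>. fa_const ((- q) ^ inversions \<pi>)
          * gu I1 (\<pi> I1) * gu I2 (\<pi> I2) * gu I3 (\<pi> I3)) - 1}
   \<union> {fa_gen (AUstar i j) - fa_const ((- q) powi (int (ix j) - int (ix i)))
          * (gu k1 l1 * gu k2 l2 - fa_const q * gu k1 l2 * gu k2 l1)
        | i j k1 k2 l1 l2. ix k1 < ix k2 \<and> {k1, k2} = UNIV - {i}
                         \<and> ix l1 < ix l2 \<and> {l1, l2} = UNIV - {j}}"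

definition SUq3_ideal :: "real \<Rightarrow> agen falg set" where
  "SUq3_ideal q = fa_star_ideal agen_star (SUq3_rels q)"

definition cstar_seminorm :: "(agen falg \<Rightarrow> real) \<Rightarrow> bool" where
  "cstar_seminorm p \<longleftrightarrow>
     (\<forall>f g. p (f + g) \<le> p f + p g) \<and>
     (\<forall>c f. p (fa_const c * f) = cmod c * p f) \<and>
     (\<forall>f g. p (f * g) \<le> p f * p g) \<and>
     (\<forall>f. p (fa_star agen_star f * f) = (p f)\<^sup>2)"

definition ueval :: "(ind \<Rightarrow> ind \<Rightarrow> 'c) \<Rightarrow> agen falg \<Rightarrow> 'c::cstar_algebra" where
  "ueval u = fa_eval scaleC (\<lambda>g. case g of AU i j \<Rightarrow> u i j | AUstar i j \<Rightarrow> adj (u i j))"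

text \<open>The type \<open>'c\<close> with the elements \<open>u i j\<close> (row \<open>i\<close>, column \<open>j\<close>) is the universal
  C*-algebra of \<open>A(SU\<^sub>q(3))\<close>: the range of \<open>ueval u\<close> is the quotient of the free *-algebra by
  the defining relations, i.e. a copy of \<open>A(SU\<^sub>q(3))\<close>; it is dense; and the norm restricts
  to the greatest C*-seminorm of \<open>A(SU\<^sub>q(3))\<close>.\<close>

locale universal_SUq3 =
  fixes q :: real and u :: "ind \<Rightarrow> ind \<Rightarrow> 'c::cstar_algebra"
  assumes kernel: "ueval u f = 0 \<longleftrightarrow> f \<in> SUq3_ideal q"
    and dense: "closure (range (ueval u)) = UNIV"
    and greatest: "cstar_seminorm p \<Longrightarrow> (\<And>f. f \<in> SUq3_ideal q \<Longrightarrow> p f = 0)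
                     \<Longrightarrow> p f \<le> norm (ueval u f)"

definition zz :: "(ind \<Rightarrow> ind \<Rightarrow> 'c) \<Rightarrow> ind \<Rightarrow> 'c" where
  "zz u i = u I3 i"

definition pp :: "(ind \<Rightarrow> ind \<Rightarrow> 'c) \<Rightarrow> ind \<Rightarrow> ind \<Rightarrow> 'c::cstar_algebra" where
  "pp u i j = adj (zz u i) * zz u j"


section \<open>The enlarged algebra and the action of \<open>U\<^sub>q(su(3))\<close>\<close>

definition root_coeff :: "real \<Rightarrow> real \<Rightarrow> nat \<Rightarrow> real \<Rightarrow> nat \<Rightarrow> real" where
  "root_coeff q t k s n = (s gchoose n) * (- (t\<^sup>2 * q ^ k)) ^ n"

text \<open>\<open>(1 - t\<^sup>2 q\<^sup>k p\<^sub>1\<^sub>1)\<^sup>s\<close> as a power series in \<open>p\<^sub>1\<^sub>1\<close>; only \<open>s = 1/2\<close> and \<open>s = -1/2\<close> are used.\<close>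

definition xroot :: "real \<Rightarrow> real \<Rightarrow> (ind \<Rightarrow> ind \<Rightarrow> 'c) \<Rightarrow> nat \<Rightarrow> real \<Rightarrow> 'c::cstar_algebra" where
  "xroot q t u k s = suminf (\<lambda>n. root_coeff q t k s n *\<^sub>R pp u I1 I1 ^ n)"

text \<open>\<open>A(SU\<^sub>q(3))\<close> enlarged by the elements \<open>(1 - t\<^sup>2 q\<^sup>k p\<^sub>1\<^sub>1)\<^sup>\<plusminus>\<^sup>1\<^sup>/\<^sup>2\<close>. A term such as
  \<open>(1 - t\<^sup>2 p\<^sub>1\<^sub>1)\<^sup>1\<^sup>/\<^sup>2 \<triangleleft> E\<^sub>2\<close> need not be a polynomial in these elements, so the algebra is
  also closed under the action. Closure under \<open>adj\<close> and scalars is automatic.\<close>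

inductive_set enlarged ::
    "real \<Rightarrow> real \<Rightarrow> (ind \<Rightarrow> ind \<Rightarrow> 'c) \<Rightarrow> (ugen falg \<Rightarrow> 'c \<Rightarrow> 'c) \<Rightarrow> 'c::cstar_algebra set"
  for q t :: real and u :: "ind \<Rightarrow> ind \<Rightarrow> 'c::cstar_algebra"
  and act :: "ugen falg \<Rightarrow> 'c \<Rightarrow> 'c" where
  poly: "ueval u f \<in> enlarged q t u act"
| root: "s \<in> {1/2, -1/2} \<Longrightarrow> xroot q t u k s \<in> enlarged q t u act"
| add: "a \<in> enlarged q t u act \<Longrightarrow> b \<in> enlarged q t u act \<Longrightarrow> a + b \<in> enlarged q t u act"
| mult: "a \<in> enlarged q t u act \<Longrightarrow> b \<in> enlarged q t u act \<Longrightarrow> a * b \<in> enlarged q t u act"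
| act: "a \<in> enlarged q t u act \<Longrightarrow> act x a \<in> enlarged q t u act"

text \<open>\<open>act x a\<close> is \<open>a \<triangleleft> x\<close>. The axioms determine \<open>act\<close> on the enlarged algebra.\<close>

locale Uq_action = universal_SUq3 q u
  for q :: real and u :: "ind \<Rightarrow> ind \<Rightarrow> 'c::cstar_algebra" +
  fixes t :: real and act :: "ugen falg \<Rightarrow> 'c \<Rightarrow> 'c"
  assumes act_add_left:
      "a \<in> enlarged q t u act \<Longrightarrow> act (x + y) a = act x a + act y a"
    and act_const:
      "a \<in> enlarged q t u act \<Longrightarrow> act (fa_const c) a = scaleC c a"
    and act_add_right:
      "a \<in> enlarged q t u act \<Longrightarrow> b \<in> enlarged q t u act \<Longrightarrow> act x (a + b) = act x a + act x b"
    and act_scaleC: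
      "a \<in> enlarged q t u act \<Longrightarrow> act x (scaleC c a) = scaleC c (act x a)"
    and act_mult:
      "a \<in> enlarged q t u act \<Longrightarrow> act (x * y) a = act y (act x a)"
    and act_ideal:
      "a \<in> enlarged q t u act \<Longrightarrow> x \<in> Uq_ideal q \<Longrightarrow> act x a = 0"
    and act_product:
      "a \<in> enlarged q t u act \<Longrightarrow> b \<in> enlarged q t u act \<Longrightarrow>
         act x (a * b) = (\<Sum>(v, w)\<in>Poly_Mapping.keys (coproduct x).
           scaleC (Poly_Mapping.lookup (coproduct x) (v, w))
             (act (Poly_Mapping.single v 1) a * act (Poly_Mapping.single w 1) b))"
    and act_adj:
      "a \<in> enlarged q t u act \<Longrightarrow>
         act x (adj a) = adj (act (fa_star ugen_star (antipode q x)) a)"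
    and act_K:
      "act (gK i) (u j k) = (q powr ((of_bool (j = up i) - of_bool (j = lo i)) / 2)) *\<^sub>R u j k"
    and act_E: "act (gE i) (u j k) = (if j = up i then u (lo i) k else 0)"
    and act_F: "act (gF i) (u j k) = (if j = lo i then u (up i) k else 0)"
    and act_root:
      "s \<in> {1/2, -1/2} \<Longrightarrow>
         (\<lambda>n. root_coeff q t m s n *\<^sub>R act x (pp u I1 I1 ^ n)) sums act x (xroot q t u m s)"

definition line_bundle ::
    "real \<Rightarrow> real \<Rightarrow> (ind \<Rightarrow> ind \<Rightarrow> 'c) \<Rightarrow> (ugen falg \<Rightarrow> 'c \<Rightarrow> 'c) \<Rightarrow> int \<Rightarrow> 'c::cstar_algebra set" where
  "line_bundle q t u act N = {a \<in> enlarged q t u act.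
     act (gK N1) a = a \<and> act (gE N1) a = 0 \<and> act (gF N1) a = 0 \<and>
     act (gK N1 * gK N2 * gK N2) a = (q powi N) *\<^sub>R a}"


section \<open>One-forms\<close>

text \<open>The first component of a one-form is its part of type \<open>(1,0)\<close>, the second one its part
  of type \<open>(0,1)\<close>; each part is a column with two entries.\<close>

type_synonym 'c form = "('c \<times> 'c) \<times> ('c \<times> 'c)"

definition form_map :: "('c \<Rightarrow> 'c) \<Rightarrow> 'c form \<Rightarrow> 'c form" where
  "form_map f = map_prod (map_prod f f) (map_prod f f)"

definition lmul :: "'c::cstar_algebra \<Rightarrow> 'c form \<Rightarrow> 'c form" (infixr "\<cdot>\<^sub>l" 72) where
  "a \<cdot>\<^sub>l \<omega> = form_map (\<lambda>v. a * v) \<omega>"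

definition rmul :: "'c::cstar_algebra form \<Rightarrow> 'c \<Rightarrow> 'c form" (infixl "\<cdot>\<^sub>r" 71) where
  "\<omega> \<cdot>\<^sub>r a = form_map (\<lambda>v. v * a) \<omega>"

fun form_star :: "real \<Rightarrow> 'c::cstar_algebra form \<Rightarrow> 'c form" where
  "form_star q ((v1, v2), (w1, w2)) =
     ((q powr (-1/2) *\<^sub>R adj w2, - (q powr (1/2) *\<^sub>R adj w1)),
      (- (q powr (-1/2) *\<^sub>R adj v2), q powr (1/2) *\<^sub>R adj v1))"

definition del_form :: "real \<Rightarrow> (ugen falg \<Rightarrow> 'c \<Rightarrow> 'c) \<Rightarrow> 'c \<Rightarrow> 'c::cstar_algebra form" where
  "del_form q act a =
     ((scaleC (\<i> * complex_of_real (q powr (-3/2))) (act (gE N2) a),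
       scaleC (\<i> * complex_of_real (q powr (-3/2))) (act (gE N2 * gE N1) a)),
      (0, 0))"

definition delbar_form :: "(ugen falg \<Rightarrow> 'c \<Rightarrow> 'c) \<Rightarrow> 'c \<Rightarrow> 'c::cstar_algebra form" where
  "delbar_form act a =
     ((0, 0),
      (scaleC \<i> (act (gF N2 * gF N1) a),
       scaleC \<i> (act (gF N2) a)))"

definition dd :: "real \<Rightarrow> (ugen falg \<Rightarrow> 'c \<Rightarrow> 'c) \<Rightarrow> 'c \<Rightarrow> 'c::cstar_algebra form" where
  "dd q act a = del_form q act a + delbar_form act a"

definition matrix_act ::
    "'c::cstar_algebra form ^ 'n ^ 'm \<Rightarrow> 'c ^ 'n::finite \<Rightarrow> 'c form ^ 'm::finite" where
  "matrix_act \<omega> \<eta> = (\<chi> i. \<Sum>j\<in>UNIV. \<omega> $ i $ j \<cdot>\<^sub>r \<eta> $ j)"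


section \<open>Connections\<close>

text \<open>The Grassmannian connection \<open>\<eta> \<mapsto> \<Psi>\<^sup>\<dagger> d(\<Psi> \<eta>)\<close> of a column resp. of a matrix, the latter
  given by the list of its rows.\<close>

definition grassmann_line ::
    "real \<Rightarrow> (ugen falg \<Rightarrow> 'c \<Rightarrow> 'c) \<Rightarrow> 'c list \<Rightarrow> 'c \<Rightarrow> 'c::cstar_algebra form" where
  "grassmann_line q act \<Psi> \<eta> = (\<Sum>a\<leftarrow>\<Psi>. adj a \<cdot>\<^sub>l dd q act (a * \<eta>))"

definition grassmann ::
    "real \<Rightarrow> (ugen falg \<Rightarrow> 'c \<Rightarrow> 'c) \<Rightarrow> ('c ^ 'n) list \<Rightarrow> 'c ^ 'n::finite
       \<Rightarrow> 'c::cstar_algebra form ^ 'n" where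
  "grassmann q act \<Psi> \<eta> =
     (\<chi> j. \<Sum>row\<leftarrow>\<Psi>. adj (row $ j) \<cdot>\<^sub>l dd q act (\<Sum>k\<in>UNIV. row $ k * \<eta> $ k))"

definition Psi_1 :: "(ind \<Rightarrow> ind \<Rightarrow> 'c) \<Rightarrow> 'c::cstar_algebra list" where
  "Psi_1 u = [adj (zz u I1), adj (zz u I2), adj (zz u I3)]"

definition Psi_m1 :: "real \<Rightarrow> (ind \<Rightarrow> ind \<Rightarrow> 'c) \<Rightarrow> 'c::cstar_algebra list" where
  "Psi_m1 q u = [q\<^sup>2 *\<^sub>R zz u I1, q *\<^sub>R zz u I2, zz u I3]"

definition psi_col :: "real \<Rightarrow> (ind \<Rightarrow> ind \<Rightarrow> 'c) \<Rightarrow> 'c::cstar_algebra list" where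
  "psi_col \<theta> u =
     [cos (2 * \<theta>) *\<^sub>R adj (zz u I1), cos \<theta> *\<^sub>R adj (zz u I2), cos \<theta> *\<^sub>R adj (zz u I3),
      0, sin \<theta> *\<^sub>R adj (zz u I3), sin \<theta> *\<^sub>R adj (zz u I2)]"

definition phi_col :: "real \<Rightarrow> real \<Rightarrow> (ind \<Rightarrow> ind \<Rightarrow> 'c) \<Rightarrow> 'c::cstar_algebra list" where
  "phi_col q \<theta> u =
     [0, - (sin \<theta> *\<^sub>R zz u I3), (q * sin \<theta>) *\<^sub>R zz u I2,
      (q\<^sup>2 * cos (2 * \<theta>)) *\<^sub>R zz u I1, (q * cos \<theta>) *\<^sub>R zz u I2, - (cos \<theta> *\<^sub>R zz u I3)]"

definition Psi_tilde ::
    "real \<Rightarrow> real \<Rightarrow> real \<Rightarrow> (ind \<Rightarrow> ind \<Rightarrow> 'c) \<Rightarrow> ('c::cstar_algebra ^ 2) list" where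
  "Psi_tilde q \<theta> t u =
     map2 (\<lambda>a b. vector [a * xroot q t u 0 (-1/2), b * xroot q t u 4 (-1/2)])
       (psi_col \<theta> u) (phi_col q \<theta> u)"

definition nabla_0 ::
    "real \<Rightarrow> (ind \<Rightarrow> ind \<Rightarrow> 'c) \<Rightarrow> (ugen falg \<Rightarrow> 'c \<Rightarrow> 'c) \<Rightarrow> 'c ^ 2
       \<Rightarrow> 'c::cstar_algebra form ^ 2" where
  "nabla_0 q u act \<eta> =
     vector [grassmann_line q act (Psi_1 u) (\<eta> $ 1),
             grassmann_line q act (Psi_m1 q u) (\<eta> $ 2)]"

definition nabla_tilde ::
    "real \<Rightarrow> real \<Rightarrow> real \<Rightarrow> (ind \<Rightarrow> ind \<Rightarrow> 'c) \<Rightarrow> (ugen falg \<Rightarrow> 'c \<Rightarrow> 'c) \<Rightarrow> 'c ^ 2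
       \<Rightarrow> 'c::cstar_algebra form ^ 2" where
  "nabla_tilde q \<theta> t u act = grassmann q act (Psi_tilde q \<theta> t u)"

end

(* Let h, f be the square root of 1 - t^2 q^k x and its inverse, where x = p_11. Elements of line bundles
   are eigenvectors of K_2, on which each of E_2, E_2 E_1, F_2 F_1, F_2 acts as a twisted derivation T:
   T(ab) = s T(a) b + r^-1 a T(b), where r, s are the eigenvalues of a, b. Write z' for the adjoint of z.
   Applying T to the relations sum z_j z_j' = 1 = sum q^(6-2j) z_j' z_j and z_2 z_3 = q z_3 z_2 gives the
   off-diagonal entries of the connection form and reduces the diagonal ones to T(x) and T(f); the two are
   related by f T(h^2) f + h T(f) + T(f) h = f T(h^2 f^2) h = 0. The connection form is unique because the
   columns (z_j, 0) and (0, z_j') are elements of L_1 + L_-1 and the two sums above equal 1. *)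

theory Submission
  imports Defs "HOL-Computational_Algebra.Formal_Power_Series"
begin

section \<open>Free algebras and their evaluation\<close>

text \<open>The constants come from the twist. As \<open>z_j\<close> has weight
  \<open>q^(1/2)\<close>, the monopole connections are \<open>q^(1/2) d\<close> on L_1 and
  \<open>q^(-1/2) d\<close> on L_-1. When T falls on f in f \<eta>, a second such factor appears;
  hence q in front of A^* and 1/q in front of B. T(x) and x need not commute, so h T(f) and T(f) h
  have to be kept apart. The type of the form separates them: T of type (0,1) kills
  \<open>z_j\<close>, T of type (1,0) kills its adjoint. So in each diagonal entry the term with
  T(x) occurs in one type only, and there it replaces h T(f) by - T(f) h. This is why differences of
  a form and its adjoint appear. Two points precede the calculus. The line bundles fix the
  eigenvalue of \<open>K_2^2\<close>, whereas the coproduct of \<open>E_2\<close> involves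
  \<open>K_2\<close>; the sign of the root is settled by decomposing the enlarged algebra under
  \<open>K_2\<close>. And the series for h and f converge because the norm of x is at most 1, which
  is derived from the relations and the C*-identity.\<close>

lemma falg_induct [case_names zero single add]:
  fixes f :: "'a \<Rightarrow>\<^sub>0 'b::ab_group_add"
  assumes "P 0" "\<And>w c. P (Poly_Mapping.single w c)" "\<And>f g. P f \<Longrightarrow> P g \<Longrightarrow> P (f + g)"
  shows "P f"
proof (induction f rule: update_induct)
  case const
  then show ?case by (rule assms(1))
next
  case (update f a b)
  have "Poly_Mapping.update a b f = Poly_Mapping.single a b + f"
    using update(1)
    by (intro poly_mapping_eqI) (auto simp: lookup_update lookup_add lookup_single when_def in_keys_iff)
  then show ?case using update assms by simp
qed

text \<open>The sum runs over the support, which may shrink in \<open>f + g\<close> through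
  cancellation. As \<open>T w 0 = 0\<close>, all three sums can be taken over the union of the
  supports of \<open>f\<close> and \<open>g\<close>.\<close>

lemma linear_extension_additive:
  fixes T :: "'a \<Rightarrow> 'b::ab_group_add \<Rightarrow> 'd::ab_group_add"
  assumes 0: "\<And>w. T w 0 = 0" and add: "\<And>w a b. T w (a + b) = T w a + T w b"
  defines "L \<equiv> \<lambda>f. \<Sum>w\<in>Poly_Mapping.keys f. T w (Poly_Mapping.lookup f w)"
  shows "L (f + g) = L f + L g" and "L (Poly_Mapping.single w c) = T w c"
proof -
  let ?S = "Poly_Mapping.keys f \<union> Poly_Mapping.keys g"
  have ext: "L h = (\<Sum>w\<in>?S. T w (Poly_Mapping.lookup h w))" if "Poly_Mapping.keys h \<subseteq> ?S" for h
    unfolding L_def using that by (intro sum.mono_neutral_left) (auto simp: in_keys_iff 0)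
  have "L (f + g) = (\<Sum>w\<in>?S. T w (Poly_Mapping.lookup f w + Poly_Mapping.lookup g w))"
    using ext[of "f + g"] Poly_Mapping.keys_add[of f g] by (simp add: lookup_add)
  also have "\<dots> = L f + L g"
    by (simp add: ext add sum.distrib)
  finally show "L (f + g) = L f + L g" .
  show "L (Poly_Mapping.single w c) = T w c"
    by (simp add: L_def 0)
qed

lemma scaleC_0_left [simp]: "scaleC 0 (a::'c::cstar_algebra) = 0"
  using scaleC_of_real[of 0 a] by simp

lemma scaleC_1 [simp]: "scaleC 1 (a::'c::cstar_algebra) = a"
  using scaleC_of_real[of 1 a] by simp

lemma scaleC_0_right [simp]: "scaleC c (0::'c::cstar_algebra) = 0"
  using scaleC_add_right[of c 0 "0::'c"] by simp

lemma scaleC_minus_right: "scaleC c (- a) = - scaleC c (a::'c::cstar_algebra)"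
  using scaleC_add_right[of c a "-a"] by (simp add: eq_neg_iff_add_eq_0 add.commute)

lemma scaleC_minus_left: "scaleC (- c) a = - scaleC c (a::'c::cstar_algebra)"
  using scaleC_add_left[of c "-c" a] by (simp add: eq_neg_iff_add_eq_0 add.commute)

lemma scaleC_diff_right: "scaleC c (a - b) = scaleC c a - scaleC c (b::'c::cstar_algebra)"
  using scaleC_add_right[of c a "-b"] by (simp add: scaleC_minus_right)

lemma scaleC_scaleR: "scaleC c (r *\<^sub>R a) = r *\<^sub>R scaleC c (a::'c::cstar_algebra)"
  by (simp add: scaleC_of_real[symmetric] scaleC_scaleC mult.commute)

lemma adj_0 [simp]: "adj (0::'c::cstar_algebra) = 0"
  using adj_add[of 0 "0::'c"] by simp

lemma adj_minus: "adj (- a) = - adj (a::'c::cstar_algebra)"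
  using adj_add[of a "-a"] by (simp add: eq_neg_iff_add_eq_0 add.commute)

lemma adj_diff: "adj (a - b) = adj a - adj (b::'c::cstar_algebra)"
  using adj_add[of a "-b"] by (simp add: adj_minus)

lemma adj_1 [simp]: "adj (1::'c::cstar_algebra) = 1"
  by (metis adj_adj adj_mult mult.right_neutral)

lemma adj_scaleR: "adj (r *\<^sub>R a) = r *\<^sub>R adj (a::'c::cstar_algebra)"
  using adj_scaleC[of "complex_of_real r" a] by (simp add: scaleC_of_real)

lemma norm_adj [simp]: "norm (adj a) = norm (a::'c::cstar_algebra)"
proof -
  have le: "norm b \<le> norm (adj b)" for b :: 'c
  proof (cases "b = 0")
    case False
    have "norm b * norm b \<le> norm (adj b) * norm b"
      using norm_mult_ineq[of "adj b" b] by (simp add: cstar_identity power2_eq_square)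
    then show ?thesis using False by simp
  qed simp
  show ?thesis using le[of a] le[of "adj a"] by (simp add: adj_adj)
qed

lemma prod_list_map_letters:
  "prod_list (map \<gamma> (letters (v + w))) = prod_list (map \<gamma> (letters v)) * prod_list (map \<gamma> (letters w))"
  by (simp add: plus_fmon_def)

context
  fixes \<gamma> :: "'g \<Rightarrow> 'c::cstar_algebra"
begin

lemma fa_eval_add: "fa_eval scaleC \<gamma> (f + g) = fa_eval scaleC \<gamma> f + fa_eval scaleC \<gamma> g"
  unfolding fa_eval_def
  by (rule linear_extension_additive(1)[where T="\<lambda>w c. scaleC c (prod_list (map \<gamma> (letters w)))"])
     (auto simp: scaleC_add_left)

lemma fa_eval_single:
  "fa_eval scaleC \<gamma> (Poly_Mapping.single w c) = scaleC c (prod_list (map \<gamma> (letters w)))"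
  by (simp add: fa_eval_def)

lemma fa_eval_0 [simp]: "fa_eval scaleC \<gamma> 0 = 0"
  by (simp add: fa_eval_def)

lemma fa_eval_mult: "fa_eval scaleC \<gamma> (f * g) = fa_eval scaleC \<gamma> f * fa_eval scaleC \<gamma> g"
proof (induction f rule: falg_induct)
  case (single v a)
  show ?case
    by (induction g rule: falg_induct)
       (auto simp: mult_single fa_eval_single fa_eval_add prod_list_map_letters scaleC_scaleC
         mult_scaleC_left mult_scaleC_right distrib_left mult.commute)
qed (auto simp: fa_eval_add distrib_right)

end

context
  fixes u :: "ind \<Rightarrow> ind \<Rightarrow> 'c::cstar_algebra"
begin

lemma ueval_add: "ueval u (f + g) = ueval u f + ueval u g"
  by (simp add: ueval_def fa_eval_add)

lemma ueval_0 [simp]: "ueval u 0 = 0"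
  by (simp add: ueval_def)

lemma ueval_minus: "ueval u (- f) = - ueval u f"
  using ueval_add[of f "- f"] by (simp add: eq_neg_iff_add_eq_0 add.commute)

lemma ueval_diff: "ueval u (f - g) = ueval u f - ueval u g"
  using ueval_add[of f "- g"] by (simp add: ueval_minus)

lemma ueval_mult: "ueval u (f * g) = ueval u f * ueval u g"
  by (simp add: ueval_def fa_eval_mult)

lemma ueval_sum: "ueval u (\<Sum>i\<in>I. f i) = (\<Sum>i\<in>I. ueval u (f i))"
  by (induction I rule: infinite_finite_induct) (auto simp: ueval_add)

lemma ueval_const: "ueval u (fa_const c) = scaleC c 1"
  by (simp add: ueval_def fa_const_def fa_eval_single zero_fmon_def)

lemma ueval_1 [simp]: "ueval u 1 = 1"
  using ueval_const[of 1] by (simp add: fa_const_def)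

lemma ueval_gen: "ueval u (fa_gen g) = (case g of AU i j \<Rightarrow> u i j | AUstar i j \<Rightarrow> adj (u i j))"
  by (simp add: ueval_def fa_gen_def fa_eval_single)

lemmas ueval_simps = ueval_add ueval_diff ueval_mult ueval_const ueval_gen ueval_sum

end

section \<open>Commutation relations\<close>

lemma UNIV_ind: "(UNIV::ind set) = {I1, I2, I3}"
  using ind.exhaust by blast

lemma scale1_mult: "scaleC (complex_of_real r) 1 * (a::'c::cstar_algebra) = r *\<^sub>R a"
  by (simp add: scaleC_of_real)

context universal_SUq3
begin

abbreviation z1 where "z1 \<equiv> u I3 I1"
abbreviation z2 where "z2 \<equiv> u I3 I2"
abbreviation z3 where "z3 \<equiv> u I3 I3"

section \<open>The defining relations as identities between the \<open>u i j\<close>\<close>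

lemma ueval_rel: "r \<in> SUq3_rels q \<Longrightarrow> ueval u r = 0"
  unfolding kernel SUq3_ideal_def by (rule fa_star_ideal.rel)

lemma rel_col:
  assumes "ix i < ix j" shows "u i k * u j k = q *\<^sub>R (u j k * u i k)"
proof -
  have "gu i k * gu j k - fa_const q * gu j k * gu i k \<in> SUq3_rels q"
    unfolding SUq3_rels_def using assms by blast
  from ueval_rel[OF this] show ?thesis
    by (simp add: ueval_simps scale1_mult)
qed

lemma rel_row:
  assumes "ix i < ix j" shows "u k i * u k j = q *\<^sub>R (u k j * u k i)"
proof -
  have "gu k i * gu k j - fa_const q * gu k j * gu k i \<in> SUq3_rels q"
    unfolding SUq3_rels_def using assms by blast
  from ueval_rel[OF this] show ?thesis
    by (simp add: ueval_simps scale1_mult)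
qed

lemma rel_commute:
  assumes "ix i < ix j" "ix k < ix l" shows "u i l * u j k = u j k * u i l"
proof -
  have "gu i l * gu j k - gu j k * gu i l \<in> SUq3_rels q"
    unfolding SUq3_rels_def using assms by blast
  from ueval_rel[OF this] show ?thesis
    by (simp add: ueval_simps)
qed

lemma rel_cross:
  assumes "ix i < ix j" "ix k < ix l"
  shows "u i k * u j l = u j l * u i k + (q - 1 / q) *\<^sub>R (u i l * u j k)"
proof -
  have "gu i k * gu j l - gu j l * gu i k - fa_const (q - 1 / q) * gu i l * gu j k \<in> SUq3_rels q"
    unfolding SUq3_rels_def using assms by blast
  from ueval_rel[OF this] show ?thesis
    by (simp add: ueval_simps scale1_mult algebra_simps del: of_real_divide of_real_diff
       add: of_real_diff[symmetric] of_real_divide[symmetric])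
qed

lemma rel_star:
  assumes "ix k1 < ix k2" "{k1, k2} = UNIV - {i}" "ix l1 < ix l2" "{l1, l2} = UNIV - {j}"
  shows "adj (u i j) = ((- q) powi (int (ix j) - int (ix i))) *\<^sub>R
           (u k1 l1 * u k2 l2 - q *\<^sub>R (u k1 l2 * u k2 l1))"
proof -
  let ?c = "(- q) powi (int (ix j) - int (ix i))"
  have "fa_gen (AUstar i j) - fa_const ?c
          * (gu k1 l1 * gu k2 l2 - fa_const q * gu k1 l2 * gu k2 l1) \<in> SUq3_rels q"
    unfolding SUq3_rels_def using assms by blast
  from ueval_rel[OF this]
  have "adj (u i j) = scaleC (complex_of_real ?c) 1 * (u k1 l1 * u k2 l2 - scaleC (complex_of_real q) 1 * u k1 l2 * u k2 l1)"
    by (simp add: ueval_simps del: of_real_minus of_real_power_int)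
  then show ?thesis by (simp only: scale1_mult mult.assoc) (simp add: scaleC_of_real)
qed

lemma rel_det:
  "(\<Sum>\<pi> | bij \<pi>. ((- q) ^ inversions \<pi>) *\<^sub>R (u I1 (\<pi> I1) * u I2 (\<pi> I2) * u I3 (\<pi> I3))) = 1"
proof -
  have "(\<Sum>\<pi> | bij \<pi>. fa_const (complex_of_real ((- q) ^ inversions \<pi>))
          * gu I1 (\<pi> I1) * gu I2 (\<pi> I2) * gu I3 (\<pi> I3)) - 1 \<in> SUq3_rels q"
    unfolding SUq3_rels_def by auto
  from ueval_rel[OF this] show ?thesis
    by (simp add: ueval_simps scale1_mult del: of_real_minus of_real_power)
qed


section \<open>The third row, its adjoints, and the two sphere relations\<close>

lemma adj_z1: "adj z1 = (1 / q\<^sup>2) *\<^sub>R (u I1 I2 * u I2 I3 - q *\<^sub>R (u I1 I3 * u I2 I2))"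
proof -
  have "{I1, I2} = UNIV - {I3}" "{I2, I3} = UNIV - {I1}" by (auto simp: UNIV_ind)
  from rel_star[OF _ this(1) _ this(2)] show ?thesis
    by (simp add: power_int_def divide_simps)
qed

lemma adj_z2: "adj z2 = (- 1 / q) *\<^sub>R (u I1 I1 * u I2 I3 - q *\<^sub>R (u I1 I3 * u I2 I1))"
proof -
  have "{I1, I2} = UNIV - {I3}" "{I1, I3} = UNIV - {I2}" by (auto simp: UNIV_ind)
  from rel_star[OF _ this(1) _ this(2)] show ?thesis
    by (simp add: power_int_def divide_simps)
qed

lemma adj_z3: "adj z3 = u I1 I1 * u I2 I2 - q *\<^sub>R (u I1 I2 * u I2 I1)"
proof -
  have "{I1, I2} = UNIV - {I3}" by (auto simp: UNIV_ind)
  from rel_star[OF _ this _ this] show ?thesis by simp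
qed

lemma z_commute: "z1 * z2 = q *\<^sub>R (z2 * z1)" "z1 * z3 = q *\<^sub>R (z3 * z1)" "z2 * z3 = q *\<^sub>R (z3 * z2)"
  by (rule rel_row; simp)+

lemma mult_assoc_rule: "a * b = c \<Longrightarrow> a * (b * d) = c * (d::'c)"
  by (simp add: mult.assoc[symmetric])

text \<open>The adjoints of the third row are quantum minors of rows 1 and 2. Used as rewrite rules,
  \<open>past_z1\<close> to \<open>past_z3\<close> carry entries of these rows to the right of those
  of row 3, so relations between \<open>z_j\<close> and the adjoints follow by comparing normally
  ordered expressions.\<close>

lemma past_z1:
  "u I1 I1 * z1 = q *\<^sub>R (z1 * u I1 I1)" "u I2 I1 * z1 = q *\<^sub>R (z1 * u I2 I1)"
  "u I1 I2 * z1 = z1 * u I1 I2" "u I2 I2 * z1 = z1 * u I2 I2"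
  "u I1 I3 * z1 = z1 * u I1 I3" "u I2 I3 * z1 = z1 * u I2 I3"
  by (rule rel_col rel_commute; simp)+

lemma past_z2:
  "u I1 I1 * z2 = z2 * u I1 I1 + (q - 1 / q) *\<^sub>R (z1 * u I1 I2)"
  "u I2 I1 * z2 = z2 * u I2 I1 + (q - 1 / q) *\<^sub>R (z1 * u I2 I2)"
  "u I1 I2 * z2 = q *\<^sub>R (z2 * u I1 I2)" "u I2 I2 * z2 = q *\<^sub>R (z2 * u I2 I2)"
  "u I1 I3 * z2 = z2 * u I1 I3" "u I2 I3 * z2 = z2 * u I2 I3"
  by (subst past_z1[symmetric], rule rel_cross; simp) (subst past_z1[symmetric], rule rel_cross; simp | rule rel_col rel_commute; simp)+

lemma past_z3:
  "u I1 I1 * z3 = z3 * u I1 I1 + (q - 1 / q) *\<^sub>R (z1 * u I1 I3)"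
  "u I2 I1 * z3 = z3 * u I2 I1 + (q - 1 / q) *\<^sub>R (z1 * u I2 I3)"
  "u I1 I2 * z3 = z3 * u I1 I2 + (q - 1 / q) *\<^sub>R (z2 * u I1 I3)"
  "u I2 I2 * z3 = z3 * u I2 I2 + (q - 1 / q) *\<^sub>R (z2 * u I2 I3)"
  "u I1 I3 * z3 = q *\<^sub>R (z3 * u I1 I3)" "u I2 I3 * z3 = q *\<^sub>R (z3 * u I2 I3)"
  by (subst past_z1[symmetric], rule rel_cross; simp) (subst past_z1[symmetric] past_z2[symmetric], rule rel_cross; simp | rule rel_col rel_commute; simp)+

lemmas past_z = past_z1 past_z2 past_z3
lemmas past_z_assoc = past_z[THEN mult_assoc_rule]

lemma z1_normal: "adj z1 * z1 = z1 * adj z1"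
  by (simp add: adj_z1 past_z past_z_assoc algebra_simps)

lemma adj_z1_z:
  "adj z1 * z2 = q *\<^sub>R (z2 * adj z1)" "adj z1 * z3 = q *\<^sub>R (z3 * adj z1)"
  by (simp_all add: adj_z1 past_z past_z_assoc algebra_simps)

lemma adj_z2_z2:
  assumes "q \<noteq> 0"
  shows "adj z2 * z2 = z2 * adj z2 + (1 - q\<^sup>2) *\<^sub>R (z1 * adj z1)"
  using assms
  by (simp add: adj_z1 adj_z2 past_z past_z_assoc algebra_simps diff_divide_distrib power2_eq_square)

lemma adj_z3_z3:
  assumes "q \<noteq> 0"
  shows "adj z3 * z3 = z3 * adj z3 + (1 - q\<^sup>2) *\<^sub>R (z2 * adj z2) + (1 - q\<^sup>2) *\<^sub>R (z1 * adj z1)"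
  using assms
  by (simp add: adj_z1 adj_z2 adj_z3 past_z past_z_assoc algebra_simps diff_divide_distrib power2_eq_square)

lemma bij_ind_iff:
  "bij \<pi> \<longleftrightarrow> \<pi> I1 \<noteq> \<pi> I2 \<and> \<pi> I1 \<noteq> \<pi> I3 \<and> \<pi> I2 \<noteq> (\<pi> I3 :: ind)"
proof -
  have "bij \<pi> \<longleftrightarrow> inj \<pi>"
    by (metis bij_betw_def finite_UNIV_inj_surj finite)
  also have "\<dots> \<longleftrightarrow> (\<forall>a\<in>{I1, I2, I3}. \<forall>b\<in>{I1, I2, I3}. \<pi> a = \<pi> b \<longrightarrow> a = b)"
    unfolding inj_on_def UNIV_ind ..
  also have "\<dots> \<longleftrightarrow> \<pi> I1 \<noteq> \<pi> I2 \<and> \<pi> I1 \<noteq> \<pi> I3 \<and> \<pi> I2 \<noteq> \<pi> I3"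
    by auto
  finally show ?thesis .
qed

lemma inversions_sum:
  "inversions \<pi> = of_bool (ix (\<pi> I2) < ix (\<pi> I1)) + of_bool (ix (\<pi> I3) < ix (\<pi> I1))
     + of_bool (ix (\<pi> I3) < ix (\<pi> I2))"
proof -
  have "{(i, j). ix i < ix j \<and> ix (\<pi> j) < ix (\<pi> i)} =
     (if ix (\<pi> I2) < ix (\<pi> I1) then {(I1, I2)} else {}) \<union>
     (if ix (\<pi> I3) < ix (\<pi> I1) then {(I1, I3)} else {}) \<union>
     (if ix (\<pi> I3) < ix (\<pi> I2) then {(I2, I3)} else {})" (is "_ = ?A")
  proof (rule set_eqI)
    fix p :: "ind \<times> ind"
    show "p \<in> {(i, j). ix i < ix j \<and> ix (\<pi> j) < ix (\<pi> i)} \<longleftrightarrow> p \<in> ?A"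
      by (cases p; cases "fst p"; cases "snd p") auto
  qed
  then show ?thesis by (simp add: inversions_def)
qed

text \<open>Encodes a permutation by its three values, so that the sum in \<open>rel_det\<close>
  becomes six explicit terms.\<close>

definition ind_fun :: "ind \<Rightarrow> ind \<Rightarrow> ind \<Rightarrow> ind \<Rightarrow> ind" where
  "ind_fun a b c i = (case i of I1 \<Rightarrow> a | I2 \<Rightarrow> b | I3 \<Rightarrow> c)"

lemma ind_fun_simps [simp]: "ind_fun a b c I1 = a" "ind_fun a b c I2 = b" "ind_fun a b c I3 = c"
  by (simp_all add: ind_fun_def)

lemma ind_fun_eq: "ind_fun a b c = ind_fun a' b' c' \<longleftrightarrow> a = a' \<and> b = b' \<and> c = c'"
  by (metis ind_fun_simps)

lemma bij_ind_enum:
  "{\<pi>. bij \<pi>} = {ind_fun I1 I2 I3, ind_fun I2 I1 I3, ind_fun I1 I3 I2, ind_fun I3 I1 I2,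
     ind_fun I2 I3 I1, ind_fun I3 I2 I1}" (is "_ = ?S")
proof (rule set_eqI)
  fix \<pi> :: "ind \<Rightarrow> ind"
  have *: "\<pi> = ind_fun (\<pi> I1) (\<pi> I2) (\<pi> I3)"
  proof
    fix i show "\<pi> i = ind_fun (\<pi> I1) (\<pi> I2) (\<pi> I3) i" by (cases i) auto
  qed
  show "\<pi> \<in> {\<pi>. bij \<pi>} \<longleftrightarrow> \<pi> \<in> ?S"
    apply (subst (2) *)
    by (simp add: bij_ind_iff ind_fun_eq) (cases "\<pi> I1"; cases "\<pi> I2"; cases "\<pi> I3"; simp)
qed

text \<open>Laplace expansion of the quantum determinant along row 3. The minor in front of
  \<open>z_j\<close> is \<open>(-q)^(3-j)\<close> times \<open>adj z_j\<close>, and the inversions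
  that involve row 3 contribute another \<open>(-q)^(3-j)\<close>; together these are the weights
  \<open>q^4\<close>, \<open>q^2\<close>, \<open>1\<close>.\<close>

lemma weighted_sum_adj_z:
  assumes "q \<noteq> 0"
  shows "q ^ 4 *\<^sub>R (adj z1 * z1) + q\<^sup>2 *\<^sub>R (adj z2 * z2) + adj z3 * z3 = 1"
proof -
  have "adj z3 * z3 + q\<^sup>2 *\<^sub>R (adj z2 * z2) + q ^ 4 *\<^sub>R (adj z1 * z1) = 1"
    using rel_det assms unfolding bij_ind_enum
    by (simp add: ind_fun_eq inversions_sum adj_z1 adj_z2 adj_z3 algebra_simps
        power2_eq_square power3_eq_cube power4_eq_xxxx)
  then show ?thesis by (simp add: algebra_simps)
qed

text \<open>Reordering each product by \<open>adj_z2_z2\<close> and \<open>adj_z3_z3\<close>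
  produces corrections with the factor \<open>1 - q^2\<close>, which complete the weights
  \<open>q^4\<close>, \<open>q^2\<close>, \<open>1\<close> to 1.\<close>

lemma sum_z_adj:
  assumes "q \<noteq> 0"
  shows "z1 * adj z1 + z2 * adj z2 + z3 * adj z3 = 1"
  using weighted_sum_adj_z[OF assms]
  by (simp add: adj_z2_z2[OF assms] adj_z3_z3[OF assms] z1_normal algebra_simps
        power2_eq_square power4_eq_xxxx)

end

section \<open>The norm of \<open>p\<^sub>1\<^sub>1\<close> and its power series\<close>

instance cstar_algebra \<subseteq> banach ..

locale quantum_su3 = Uq_action q u t act
  for q :: real and u :: "ind \<Rightarrow> ind \<Rightarrow> 'c::cstar_algebra" and t :: real
    and act :: "ugen falg \<Rightarrow> 'c \<Rightarrow> 'c" +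
  assumes q_pos: "0 < q" and q_less_1: "q < 1" and t_nonneg: "0 \<le> t" and t_less_1: "t < 1"
begin

lemma q_nonzero: "q \<noteq> 0"
  using q_pos by simp

abbreviation p11 where "p11 \<equiv> pp u I1 I1"

lemma p11_eq: "p11 = adj z1 * z1" "p11 = z1 * adj z1"
  by (simp_all add: pp_def zz_def z1_normal)

lemma adj_p11_power: "adj (p11 ^ n) = p11 ^ n"
proof (induction n)
  case (Suc n)
  have "adj p11 = p11"
    by (simp add: pp_def adj_mult adj_adj)
  then show ?case using Suc by (simp add: adj_mult power_commutes)
qed simp

lemma one_minus_p11: "1 - p11 = z2 * adj z2 + z3 * adj z3"
  using sum_z_adj[OF q_nonzero] by (simp add: p11_eq(2) algebra_simps)

lemma p11_z: "p11 * z2 = q\<^sup>2 *\<^sub>R (z2 * p11)" "p11 * z3 = q\<^sup>2 *\<^sub>R (z3 * p11)"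
proof -
  have *: "p11 * w = q\<^sup>2 *\<^sub>R (w * p11)" if "z1 * w = q *\<^sub>R (w * z1)" "adj z1 * w = q *\<^sub>R (w * adj z1)" for w
  proof -
    have "p11 * w = adj z1 * (z1 * w)" by (simp add: p11_eq(1) mult.assoc)
    also have "\<dots> = q *\<^sub>R ((adj z1 * w) * z1)" by (simp add: that(1) mult.assoc)
    also have "\<dots> = q\<^sup>2 *\<^sub>R (w * p11)" by (simp add: that(2) p11_eq(1) mult.assoc power2_eq_square)
    finally show ?thesis .
  qed
  show "p11 * z2 = q\<^sup>2 *\<^sub>R (z2 * p11)" "p11 * z3 = q\<^sup>2 *\<^sub>R (z3 * p11)"
    by (rule *; simp add: z_commute adj_z1_z)+
qed

lemma power_commute_scaled:
  fixes a w :: 'c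
  assumes "a * w = r *\<^sub>R (w * a)"
  shows "a ^ n * w = r ^ n *\<^sub>R (w * a ^ n)"
proof (induction n)
  case (Suc n)
  have "a ^ Suc n * w = a * (a ^ n * w)" by (simp add: mult.assoc)
  also have "\<dots> = r ^ n *\<^sub>R ((a * w) * a ^ n)" by (simp add: Suc mult.assoc)
  also have "\<dots> = r ^ Suc n *\<^sub>R (w * a ^ Suc n)" by (simp add: assms mult.assoc mult.commute)
  finally show ?case .
qed simp

lemma norm_p11_power_two_power: "norm (p11 ^ (2 ^ m)) = norm p11 ^ (2 ^ m)"
proof (induction m)
  case (Suc m)
  have "p11 ^ (2 ^ Suc m) = adj (p11 ^ (2 ^ m)) * p11 ^ (2 ^ m)"
    by (simp add: adj_p11_power mult_2 power_add)
  then have "norm (p11 ^ (2 ^ Suc m)) = (norm p11 ^ (2 ^ m))\<^sup>2"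
    using Suc by (simp only: cstar_identity)
  then show ?case by (simp only: power_mult[symmetric] power_Suc mult.commute)
qed simp

text \<open>Let \<open>x = p\<^sub>1\<^sub>1\<close>. As \<open>1 - x\<close> is a sum of terms \<open>w w\<^sup>*\<close> with \<open>x w = q\<^sup>2 w x\<close>, the powers of \<open>x\<close>
  satisfy \<open>\<parallel>x\<^sup>n - x\<^sup>n\<^sup>+\<^sup>1\<parallel> \<le> C q\<^sup>2\<^sup>n \<parallel>x\<parallel>\<^sup>n\<close>. Together with \<open>\<parallel>x\<^sup>m\<parallel> = \<parallel>x\<parallel>\<^sup>m\<close> for powers \<open>m\<close> of two
  this gives the bound without any spectral theory.\<close>

lemma norm_p11_le_1: "norm p11 \<le> 1"
proof (cases "norm p11 = 0")
  case False
  define r where "r = norm p11"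
  have r: "r > 0" using False by (simp add: r_def less_le)
  define C where "C = norm z2 ^ 2 + norm z3 ^ 2"
  have npow: "norm (p11 ^ n) \<le> r ^ n" for n unfolding r_def by (rule norm_power_ineq)
  have diff: "norm (p11 ^ n - p11 ^ Suc n) \<le> C * (q ^ 2) ^ n * r ^ n" for n
  proof -
    have "p11 ^ n - p11 ^ Suc n = p11 ^ n * (1 - p11)"
      by (simp add: right_diff_distrib power_commutes)
    also have "\<dots> = (p11 ^ n * z2) * adj z2 + (p11 ^ n * z3) * adj z3"
      by (simp add: one_minus_p11 distrib_left mult.assoc)
    also have "\<dots> = (q ^ 2) ^ n *\<^sub>R (z2 * p11 ^ n * adj z2 + z3 * p11 ^ n * adj z3)"
      by (simp add: power_commute_scaled[OF p11_z(1)] power_commute_scaled[OF p11_z(2)] scaleR_add_right)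
    finally have eq: "norm (p11 ^ n - p11 ^ Suc n)
        = (q ^ 2) ^ n * norm (z2 * p11 ^ n * adj z2 + z3 * p11 ^ n * adj z3)"
      by simp
    have b: "norm (w * p11 ^ n * adj w) \<le> norm w ^ 2 * r ^ n" for w
    proof -
      have "norm (w * p11 ^ n * adj w) \<le> norm w * norm (p11 ^ n) * norm (adj w)"
        by (meson mult_right_mono norm_ge_zero norm_mult_ineq order_trans)
      also have "\<dots> = norm w ^ 2 * norm (p11 ^ n)" by (simp add: power2_eq_square)
      also have "\<dots> \<le> norm w ^ 2 * r ^ n" by (intro mult_left_mono npow) simp
      finally show ?thesis .
    qed
    have "norm (z2 * p11 ^ n * adj z2 + z3 * p11 ^ n * adj z3) \<le> C * r ^ n"
      using norm_triangle_ineq[of "z2 * p11 ^ n * adj z2" "z3 * p11 ^ n * adj z3"] b[of z2] b[of z3]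
      by (simp add: C_def distrib_right)
    then show ?thesis
      unfolding eq using mult_left_mono[of _ "C * r ^ n" "(q ^ 2) ^ n"]
      by (simp add: mult.assoc mult.left_commute)
  qed
  have step: "r \<le> 1 + C * (q\<^sup>2) ^ (2 ^ m)" for m :: nat
  proof -
    define N where "N = (2::nat) ^ m"
    have N: "N > 0" by (simp add: N_def)
    have "r ^ (2 * N) = norm (p11 ^ (2 * N))"
      using norm_p11_power_two_power[of "Suc m"] by (simp add: r_def N_def)
    \<comment> \<open>The first factor has exponent \<open>N + 1\<close>, but being close to
      \<open>p11 ^ N\<close> it is bounded by \<open>r ^ N\<close> up to the factor
      \<open>1 + C q^(2N)\<close>. This saves one power of \<open>r\<close> against the left side
      \<open>r ^ (2 * N)\<close>.\<close>
    also have "p11 ^ (2 * N) = p11 ^ Suc N * p11 ^ (N - 1)"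
      using N by (simp add: power_add[symmetric] mult_2 del: power_Suc)
    also have "norm \<dots> \<le> norm (p11 ^ Suc N) * norm (p11 ^ (N - 1))"
      by (rule norm_mult_ineq)
    also have "\<dots> \<le> (r ^ N + C * (q ^ 2) ^ N * r ^ N) * r ^ (N - 1)"
    proof (intro mult_mono npow)
      show "norm (p11 ^ Suc N) \<le> r ^ N + C * (q ^ 2) ^ N * r ^ N"
        using norm_triangle_sub[of "p11 ^ Suc N" "p11 ^ N"] npow[of N] diff[of N]
        by (simp add: norm_minus_commute)
      show "0 \<le> r ^ N + C * (q ^ 2) ^ N * r ^ N"
        using r by (simp add: C_def)
    qed simp
    also have "\<dots> = (1 + C * (q ^ 2) ^ N) * r ^ (2 * N - 1)"
    proof -
      have "2 * N - 1 = N + (N - 1)" using N by simp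
      then show ?thesis by (simp only: power_add) (simp add: algebra_simps)
    qed
    also have "r ^ (2 * N) = r * r ^ (2 * N - 1)"
      using N by (simp flip: power_Suc)
    finally show ?thesis using r by (simp add: N_def)
  qed
  have "(\<lambda>m. 1 + C * (q\<^sup>2) ^ (2 ^ m)) \<longlonglongrightarrow> 1 + C * 0"
  proof (intro tendsto_intros)
    have "(\<lambda>n. (q\<^sup>2) ^ n) \<longlonglongrightarrow> 0"
      using q_pos q_less_1 by (intro LIMSEQ_power_zero) (simp add: power_less_one_iff)
    from LIMSEQ_subseq_LIMSEQ[OF this, of "\<lambda>m. 2 ^ m"]
    show "(\<lambda>m. (q\<^sup>2) ^ (2 ^ m)) \<longlonglongrightarrow> 0"
      by (simp add: strict_mono_def o_def)
  qed
  then have "r \<le> 1 + C * 0"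
    by (rule LIMSEQ_le_const) (use step in blast)
  then show ?thesis by (simp add: r_def)
qed simp

section \<open>Binomial series in \<open>p11\<close>\<close>

abbreviation xr where "xr \<equiv> xroot q t u"

text \<open>Each step of the recursion multiplies by \<open>(s - n) / (n + 1)\<close>, of modulus at
  most 1. Bounded coefficients suffice: with \<open>norm p11 \<le> 1\<close> the series is dominated
  by the geometric series of \<open>t^2 < 1\<close>.\<close>

lemma abs_gbinomial_le_1:
  fixes s :: real
  assumes "\<bar>s\<bar> \<le> 1"
  shows "\<bar>s gchoose n\<bar> \<le> 1"
proof (induction n)
  case (Suc n)
  have "(s gchoose Suc n) = (s gchoose n) * ((s - real n) / real (Suc n))"
    using gbinomial_mult_1[of s n] by (simp add: field_simps)
  then have "\<bar>s gchoose Suc n\<bar> = \<bar>s gchoose n\<bar> * \<bar>(s - real n) / real (Suc n)\<bar>"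
    by (simp add: abs_mult)
  also have "\<dots> \<le> 1 * 1"
    using assms by (intro mult_mono Suc) (auto simp: divide_simps)
  finally show ?case by simp
qed simp

lemma t2_less_1: "t\<^sup>2 < 1"
  using t_nonneg t_less_1 by (simp add: power_less_one_iff)

lemma norm_root_term_le:
  assumes "\<bar>s\<bar> \<le> 1"
  shows "norm (root_coeff q t k s n *\<^sub>R p11 ^ n) \<le> (t\<^sup>2) ^ n"
proof -
  have "q ^ k \<le> 1" using q_pos q_less_1 by (simp add: power_le_one)
  then have "t\<^sup>2 * q ^ k \<le> t\<^sup>2" by (simp add: mult_left_le)
  then have le: "\<bar>- (t\<^sup>2 * q ^ k)\<bar> ^ n \<le> (t\<^sup>2) ^ n"
    using q_pos by (intro power_mono) (auto simp: abs_mult)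
  have "norm (root_coeff q t k s n *\<^sub>R p11 ^ n)
      = \<bar>s gchoose n\<bar> * \<bar>- (t\<^sup>2 * q ^ k)\<bar> ^ n * norm (p11 ^ n)"
    by (simp add: root_coeff_def abs_mult power_abs)
  also have "\<dots> \<le> (1 * (t\<^sup>2) ^ n) * 1"
  proof (intro mult_mono abs_gbinomial_le_1 assms le)
    have "norm (p11 ^ n) \<le> norm p11 ^ n" by (rule norm_power_ineq)
    also have "\<dots> \<le> 1" using norm_p11_le_1 by (simp add: power_le_one)
    finally show "norm (p11 ^ n) \<le> 1" .
  qed auto
  finally show ?thesis by simp
qed

lemma summable_norm_root:
  assumes "\<bar>s\<bar> \<le> 1"
  shows "summable (\<lambda>n. norm (root_coeff q t k s n *\<^sub>R p11 ^ n))"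
proof (rule summable_comparison_test)
  show "\<exists>N. \<forall>n\<ge>N. norm (norm (root_coeff q t k s n *\<^sub>R p11 ^ n)) \<le> (t\<^sup>2) ^ n"
    using norm_root_term_le[OF assms] by simp
  show "summable (\<lambda>n. (t\<^sup>2) ^ n)"
    using t2_less_1 by (intro summable_geometric) simp
qed

lemma xroot_sums:
  assumes "\<bar>s\<bar> \<le> 1"
  shows "(\<lambda>n. root_coeff q t k s n *\<^sub>R p11 ^ n) sums xr k s"
  unfolding xroot_def using summable_norm_cancel[OF summable_norm_root[OF assms]]
  by (rule summable_sums)

text \<open>Cauchy product of absolutely convergent series combined with the Vandermonde identity.
  Adding exponents takes the place of functional calculus: 1/2 and -1/2 give inverse elements, and
  1/2 twice gives a polynomial.\<close>

lemma xroot_mult: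
  assumes "\<bar>s\<bar> \<le> 1" "\<bar>s'\<bar> \<le> 1"
  shows "xr k s * xr k s' = xr k (s + s')"
proof -
  have "xr k s * xr k s' = suminf (\<lambda>n. \<Sum>i\<le>n. (root_coeff q t k s i *\<^sub>R p11 ^ i) *
      (root_coeff q t k s' (n - i) *\<^sub>R p11 ^ (n - i)))"
    unfolding xroot_def by (rule Cauchy_product[OF summable_norm_root summable_norm_root]) fact+
  also have "(\<lambda>n. \<Sum>i\<le>n. (root_coeff q t k s i *\<^sub>R p11 ^ i) *
      (root_coeff q t k s' (n - i) *\<^sub>R p11 ^ (n - i)))
      = (\<lambda>n. root_coeff q t k (s + s') n *\<^sub>R p11 ^ n)"
  proof
    fix n
    have "(\<Sum>i\<le>n. (root_coeff q t k s i *\<^sub>R p11 ^ i) * (root_coeff q t k s' (n - i) *\<^sub>R p11 ^ (n - i)))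
       = (\<Sum>i\<le>n. (((s gchoose i) * (s' gchoose (n - i))) * (- (t\<^sup>2 * q ^ k)) ^ n) *\<^sub>R p11 ^ n)"
    proof (rule sum.cong)
      fix i assume "i \<in> {..n}"
      then have n: "n = i + (n - i)" by simp
      have "p11 ^ i * p11 ^ (n - i) = p11 ^ n"
           "(- (t\<^sup>2 * q ^ k)) ^ i * (- (t\<^sup>2 * q ^ k)) ^ (n - i) = (- (t\<^sup>2 * q ^ k)) ^ n"
        by (metis n power_add)+
      then show "(root_coeff q t k s i *\<^sub>R p11 ^ i) * (root_coeff q t k s' (n - i) *\<^sub>R p11 ^ (n - i))
         = (((s gchoose i) * (s' gchoose (n - i))) * (- (t\<^sup>2 * q ^ k)) ^ n) *\<^sub>R p11 ^ n"
        unfolding root_coeff_def by (simp add: ac_simps)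
    qed simp
    also have "\<dots> = root_coeff q t k (s + s') n *\<^sub>R p11 ^ n"
      by (simp add: scaleR_sum_left[symmetric] sum_distrib_right[symmetric] root_coeff_def
          gbinomial_Vandermonde[of s s' n, symmetric] atLeast0AtMost)
    finally show "(\<Sum>i\<le>n. (root_coeff q t k s i *\<^sub>R p11 ^ i) *
      (root_coeff q t k s' (n - i) *\<^sub>R p11 ^ (n - i))) = root_coeff q t k (s + s') n *\<^sub>R p11 ^ n" .
  qed
  finally show ?thesis by (simp add: xroot_def)
qed

lemma xroot_0: "xr k 0 = 1"
proof -
  have "xr k 0 = (\<Sum>n\<in>{0}. root_coeff q t k 0 n *\<^sub>R p11 ^ n)"
    unfolding xroot_def by (rule suminf_finite) (auto simp: root_coeff_def gbinomial_0_left)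
  then show ?thesis by (simp add: root_coeff_def)
qed

lemma xroot_1: "xr k 1 = 1 - (t\<^sup>2 * q ^ k) *\<^sub>R p11"
proof -
  have "(1::real) gchoose n = 0" if "n \<notin> {0, 1}" for n
  proof -
    have "(1::nat) choose n = 0" using that by (intro binomial_eq_0) auto
    then show ?thesis by (metis binomial_gbinomial of_nat_0 of_nat_1)
  qed
  then have "xr k 1 = (\<Sum>n\<in>{0,1}. root_coeff q t k 1 n *\<^sub>R p11 ^ n)"
    unfolding xroot_def by (intro suminf_finite) (auto simp: root_coeff_def)
  then show ?thesis by (simp add: root_coeff_def)
qed

lemma xroot_cancel:
  "xr k (1/2) * xr k (-1/2) = 1" "xr k (-1/2) * xr k (1/2) = 1"
  "xr k (1/2) * xr k (1/2) = 1 - (t\<^sup>2 * q ^ k) *\<^sub>R p11"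
  by (simp_all add: xroot_mult xroot_0 xroot_1)

lemma adj_xroot:
  assumes "\<bar>s\<bar> \<le> 1" shows "adj (xr k s) = xr k s"
proof -
  have "bounded_linear (adj :: 'c \<Rightarrow> 'c)"
    by (rule bounded_linear_intro[where K=1]) (auto simp: adj_add adj_scaleR)
  from bounded_linear.sums[OF this xroot_sums[OF assms, of k]]
  have "(\<lambda>n. root_coeff q t k s n *\<^sub>R p11 ^ n) sums adj (xr k s)"
    by (simp add: adj_scaleR adj_p11_power)
  with xroot_sums[OF assms, of k] show ?thesis by (rule sums_unique2[symmetric])
qed

end

section \<open>The action on generators of \<open>U\<^sub>q(su(3))\<close>\<close>

lemma fa_star_add: "fa_star \<tau> (f + g) = fa_star \<tau> f + fa_star \<tau> g"
  unfolding fa_star_def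
  by (rule linear_extension_additive(1)[where T="\<lambda>w c. Poly_Mapping.single (Word (rev (map \<tau> (letters w)))) (cnj c)"])
     (auto simp: single_add)

lemma fa_star_single:
  "fa_star \<tau> (Poly_Mapping.single w c) = Poly_Mapping.single (Word (rev (map \<tau> (letters w)))) (cnj c)"
  by (simp add: fa_star_def)

lemma fa_star_diff: "fa_star \<tau> (f - g) = fa_star \<tau> f - fa_star \<tau> g"
  using fa_star_add[of \<tau> "f - g" g] by simp

lemma falg_word_mult:
  "Poly_Mapping.single (Word v) a * Poly_Mapping.single (Word w) b
     = Poly_Mapping.single (Word (v @ w)) (a * b :: complex)"
  by (simp add: mult_single plus_fmon_def)

lemma fa_const_word: "fa_const c = Poly_Mapping.single (Word []) c"
  by (simp add: fa_const_def zero_fmon_def)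

lemma coproduct_fa_gen: "coproduct (fa_gen g) = coproduct_gen g"
  by (simp add: coproduct_def fa_eval_def fa_gen_def)

lemma antipode_fa_gen: "antipode q (fa_gen g) = antipode_gen q g"
  by (simp add: antipode_def fa_gen_def fa_const_def)

context quantum_su3
begin

abbreviation alg where "alg \<equiv> enlarged q t u act"

lemma alg_poly: "ueval u f \<in> alg" by (rule enlarged.poly)

lemma alg_u: "u i j \<in> alg" "adj (u i j) \<in> alg"
  using alg_poly[of "fa_gen (AU i j)"] alg_poly[of "fa_gen (AUstar i j)"] by (simp_all add: ueval_gen)

lemma alg_0: "0 \<in> alg" using alg_poly[of 0] by simp

lemma alg_1: "1 \<in> alg" using alg_poly[of 1] by simp

lemma alg_scaleC: "a \<in> alg \<Longrightarrow> scaleC c a \<in> alg"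
  using enlarged.mult[OF alg_poly[of "fa_const c"], of a] by (simp add: ueval_const mult_scaleC_left)

lemma alg_scaleR: "a \<in> alg \<Longrightarrow> r *\<^sub>R a \<in> alg"
  using alg_scaleC[of a "complex_of_real r"] by (simp add: scaleC_of_real)

lemma alg_minus: "a \<in> alg \<Longrightarrow> - a \<in> alg"
  using alg_scaleR[of a "-1"] by simp

lemma alg_diff: "a \<in> alg \<Longrightarrow> b \<in> alg \<Longrightarrow> a - b \<in> alg"
  using enlarged.add[of a q t u act "- b"] alg_minus[of b] by simp

lemmas alg_add = enlarged.add[of _ q t u act]
lemmas alg_mult = enlarged.mult[of _ q t u act]
lemmas alg_act = enlarged.act[of _ q t u act]
lemmas alg_root = enlarged.root[of _ q t u _ act]

lemma alg_power: "a \<in> alg \<Longrightarrow> a ^ n \<in> alg"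
  by (induction n) (auto simp: alg_1 alg_mult)

lemmas alg_intros = alg_u alg_0 alg_1 alg_scaleC alg_scaleR alg_minus alg_diff alg_add alg_mult
  alg_act alg_power alg_root

lemma act_scaleR: "a \<in> alg \<Longrightarrow> act x (r *\<^sub>R a) = r *\<^sub>R act x a"
  using act_scaleC[of a x "complex_of_real r"] by (simp add: scaleC_of_real)

lemma act_0_right [simp]: "act x 0 = 0"
  using act_scaleR[OF alg_0, of x 0] by simp

lemma act_minus: "a \<in> alg \<Longrightarrow> act x (- a) = - act x a"
  using act_scaleR[of a x "-1"] by simp

lemma act_diff: "a \<in> alg \<Longrightarrow> b \<in> alg \<Longrightarrow> act x (a - b) = act x a - act x b"
  using act_add_right[OF _ alg_minus, of a b x] by (simp add: act_minus)

lemma act_const_mult: "a \<in> alg \<Longrightarrow> act (fa_const c * y) a = scaleC c (act y a)"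
  by (simp add: act_mult act_const act_scaleC)

lemma act_diff_left: "a \<in> alg \<Longrightarrow> act (x - y) a = act x a - act y a"
proof -
  assume a: "a \<in> alg"
  have "x - y = x + fa_const (-1) * y"
    by (simp add: fa_const_def single_uminus)
  then show ?thesis using a scaleC_minus_left[of 1 "act y a"]
    by (simp only: act_add_left act_const_mult) simp
qed

lemma act_1_left: "a \<in> alg \<Longrightarrow> act 1 a = a"
  using act_const[of a 1] by (simp add: fa_const_def)

section \<open>How the generators act on eigenvectors, products, adjoints and 1\<close>

lemma Uq_ideal_rel: "r \<in> Uq_rels q \<Longrightarrow> r \<in> Uq_ideal q"
  unfolding Uq_ideal_def by (rule fa_star_ideal.rel)

lemma act_K_Ki: "a \<in> alg \<Longrightarrow> act (gK i) (act (gKi i) a) = a"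
proof -
  assume a: "a \<in> alg"
  have "gKi i * gK i - 1 \<in> Uq_rels q" unfolding Uq_rels_def by blast
  from act_ideal[OF a Uq_ideal_rel[OF this]] show ?thesis
    using a by (simp add: act_diff_left act_mult act_1_left)
qed

lemma act_Ki_K: "a \<in> alg \<Longrightarrow> act (gKi i) (act (gK i) a) = a"
proof -
  assume a: "a \<in> alg"
  have "gK i * gKi i - 1 \<in> Uq_rels q" unfolding Uq_rels_def by blast
  from act_ideal[OF a Uq_ideal_rel[OF this]] show ?thesis
    using a by (simp add: act_diff_left act_mult act_1_left)
qed

lemma act_K_K: "a \<in> alg \<Longrightarrow> act (gK i) (act (gK j) a) = act (gK j) (act (gK i) a)"
proof -
  assume a: "a \<in> alg"
  have "gK i * gK j - gK j * gK i \<in> Uq_rels q" unfolding Uq_rels_def by blast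
  from act_ideal[OF a Uq_ideal_rel[OF this]] show ?thesis
    using a by (simp add: act_diff_left act_mult)
qed

text \<open>This is \<open>q^(a_ij / 2)\<close> for the Cartan matrix of su(3), which merges the two
  relations between \<open>K_i\<close> and \<open>E_j\<close>.\<close>

definition KE_coeff :: "node \<Rightarrow> node \<Rightarrow> real" where
  "KE_coeff i j = (if i = j then q else q powr (-1/2))"

lemma KE_coeff_pos: "KE_coeff i j > 0"
  using q_pos by (simp add: KE_coeff_def)

lemma KE_rel: "gK i * gE j * gKi i - fa_const (KE_coeff i j) * gE j \<in> Uq_ideal q"
proof (rule Uq_ideal_rel, cases "i = j")
  case True
  then show "gK i * gE j * gKi i - fa_const (KE_coeff i j) * gE j \<in> Uq_rels q"
    unfolding Uq_rels_def KE_coeff_def by auto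
next
  case False
  then have "gK i * gE j * gKi i - fa_const (q powr (-1/2)) * gE j \<in> Uq_rels q"
    unfolding Uq_rels_def by blast
  with False show "gK i * gE j * gKi i - fa_const (KE_coeff i j) * gE j \<in> Uq_rels q"
    by (simp add: KE_coeff_def)
qed

text \<open>In a right action the leftmost factor acts first, so the relation for
  \<open>K E K^-1\<close> compares \<open>K^-1\<close> applied after \<open>E\<close> with
  \<open>E\<close> alone. Hence \<open>E\<close> divides the eigenvalue by the coefficient, contrary
  to the habit from left actions.\<close>

lemma act_K_E:
  assumes a: "a \<in> alg" and r: "act (gK i) a = r *\<^sub>R a"
  shows "act (gK i) (act (gE j) a) = (r / KE_coeff i j) *\<^sub>R act (gE j) a"
proof -
  let ?k = "KE_coeff i j"
  have "r *\<^sub>R act (gKi i) (act (gE j) a) = ?k *\<^sub>R act (gE j) a"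
    using act_ideal[OF a KE_rel[of i j]] a
    by (simp add: act_diff_left act_mult act_const_mult act_const scaleC_of_real r act_scaleR alg_intros)
  from arg_cong[OF this, of "act (gK i)"]
  have "r *\<^sub>R act (gE j) a = ?k *\<^sub>R act (gK i) (act (gE j) a)"
    using a by (simp add: act_scaleR act_K_Ki alg_intros)
  then have "(1 / ?k) *\<^sub>R r *\<^sub>R act (gE j) a = (1 / ?k) *\<^sub>R ?k *\<^sub>R act (gK i) (act (gE j) a)"
    by simp
  then show ?thesis using KE_coeff_pos[of i j] by simp
qed

text \<open>The list of relations does not state how \<open>K\<close> conjugates \<open>F\<close>;
  this is the adjoint of \<open>KE_rel\<close>, available because the ideal is closed under the
  involution.\<close>

lemma KF_rel: "gKi i * gF j * gK i - fa_const (KE_coeff i j) * gF j \<in> Uq_ideal q"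
proof -
  have "fa_star ugen_star (gK i * gE j * gKi i - fa_const (KE_coeff i j) * gE j) \<in> Uq_ideal q"
    using KE_rel unfolding Uq_ideal_def by (rule fa_star_ideal.star)
  moreover have "fa_star ugen_star (gK i * gE j * gKi i - fa_const (KE_coeff i j) * gE j)
      = gKi i * gF j * gK i - fa_const (KE_coeff i j) * gF j"
    by (simp add: fa_star_diff fa_gen_def fa_const_word falg_word_mult fa_star_single)
  ultimately show ?thesis by simp
qed

lemma act_Ki_weight:
  assumes a: "a \<in> alg" and r: "act (gK i) a = r *\<^sub>R a" "r \<noteq> 0"
  shows "act (gKi i) a = (1 / r) *\<^sub>R a"
proof -
  have "a = r *\<^sub>R act (gKi i) a"
    using act_Ki_K[OF a, of i] a by (simp add: r act_scaleR)
  then have "(1 / r) *\<^sub>R a = (1 / r) *\<^sub>R r *\<^sub>R act (gKi i) a" by simp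
  then show ?thesis using r(2) by simp
qed

lemma act_K_F:
  assumes a: "a \<in> alg" and r: "act (gK i) a = r *\<^sub>R a" "r \<noteq> 0"
  shows "act (gK i) (act (gF j) a) = (r * KE_coeff i j) *\<^sub>R act (gF j) a"
proof -
  let ?k = "KE_coeff i j"
  have "(1 / r) *\<^sub>R act (gK i) (act (gF j) a) = ?k *\<^sub>R act (gF j) a"
    using act_ideal[OF a KF_rel[of i j]] a act_Ki_weight[OF a r]
    by (simp add: act_diff_left act_mult act_const_mult act_const scaleC_of_real act_scaleR alg_intros)
  then have "r *\<^sub>R (1 / r) *\<^sub>R act (gK i) (act (gF j) a) = r *\<^sub>R ?k *\<^sub>R act (gF j) a"
    by simp
  then show ?thesis using r(2) by simp
qed

lemma act_K_mult: "a \<in> alg \<Longrightarrow> b \<in> alg \<Longrightarrow> act (gK i) (a * b) = act (gK i) a * act (gK i) b"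
  by (simp add: act_product coproduct_fa_gen) (simp add: fa_gen_def)

lemma keys_two_singles:
  "v \<noteq> w \<Longrightarrow> Poly_Mapping.keys (Poly_Mapping.single v 1 + Poly_Mapping.single w (1::complex)) = {v, w}"
  by (auto simp: in_keys_iff lookup_add lookup_single when_def split: if_splits)

lemma act_E_mult:
  "a \<in> alg \<Longrightarrow> b \<in> alg \<Longrightarrow>
    act (gE i) (a * b) = act (gE i) a * act (gK i) b + act (gKi i) a * act (gE i) b"
  by (simp add: act_product coproduct_fa_gen keys_two_singles)
     (simp add: fa_gen_def lookup_add lookup_single)

lemma act_F_mult:
  "a \<in> alg \<Longrightarrow> b \<in> alg \<Longrightarrow>
    act (gF i) (a * b) = act (gF i) a * act (gK i) b + act (gKi i) a * act (gF i) b"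
  by (simp add: act_product coproduct_fa_gen keys_two_singles)
     (simp add: fa_gen_def lookup_add lookup_single)

lemma act_K_adj: "a \<in> alg \<Longrightarrow> act (gK i) (adj a) = adj (act (gKi i) a)"
  by (simp add: act_adj antipode_fa_gen) (simp add: fa_gen_def fa_star_single)

lemma act_word_scale:
  "a \<in> alg \<Longrightarrow> act (Poly_Mapping.single (Word w) c) a = scaleC c (act (Poly_Mapping.single (Word w) 1) a)"
  using act_const_mult[of a c "Poly_Mapping.single (Word w) 1"]
  by (simp add: fa_const_word falg_word_mult)

lemma act_E_adj: "a \<in> alg \<Longrightarrow> act (gE i) (adj a) = - (q *\<^sub>R adj (act (gF i) a))"
proof -
  assume a: "a \<in> alg"
  have "fa_star ugen_star (antipode q (gE i)) = Poly_Mapping.single (Word [UF i]) (complex_of_real (- q))"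
    by (simp add: antipode_fa_gen) (simp add: fa_gen_def fa_const_word falg_word_mult fa_star_single flip: single_uminus)
  then have "act (gE i) (adj a) = adj (scaleC (complex_of_real (- q)) (act (gF i) a))"
    using a act_word_scale[OF a, of "[UF i]" "complex_of_real (- q)"] by (simp add: act_adj fa_gen_def)
  then show ?thesis by (simp only: scaleC_of_real) (simp add: adj_scaleR adj_minus)
qed

lemma act_F_adj: "a \<in> alg \<Longrightarrow> act (gF i) (adj a) = - ((1 / q) *\<^sub>R adj (act (gE i) a))"
proof -
  assume a: "a \<in> alg"
  have "fa_star ugen_star (antipode q (gF i)) = Poly_Mapping.single (Word [UE i]) (complex_of_real (- (1 / q)))"
    by (simp add: antipode_fa_gen) (simp add: fa_gen_def fa_const_word falg_word_mult fa_star_single flip: single_uminus)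
  then have "act (gF i) (adj a) = adj (scaleC (complex_of_real (- (1 / q))) (act (gE i) a))"
    using a act_word_scale[OF a, of "[UE i]" "complex_of_real (- (1 / q))"] by (simp add: act_adj fa_gen_def)
  then show ?thesis by (simp only: scaleC_of_real) (simp add: adj_scaleR adj_minus)
qed

text \<open>The counit does not occur in the axioms of the action. Invariance of 1 is read off from
  the sphere relation, whose summands are products of eigenvectors with reciprocal
  eigenvalues.\<close>

lemma act_K_1: "act (gK i) 1 = 1"
proof -
  have K: "act (gK i) (z * adj z) = z * adj z" if z: "z = u I3 k" for z k
  proof -
    define r where "r = q powr ((of_bool (I3 = up i) - of_bool (I3 = lo i)) / 2)"
    have r: "r \<noteq> 0" "act (gK i) z = r *\<^sub>R z" using q_pos by (auto simp: r_def z act_K)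
    have "z \<in> alg" "adj z \<in> alg" by (auto simp: z alg_u)
    with r show ?thesis using act_Ki_weight[of z i r]
      by (simp add: act_K_mult act_K_adj adj_scaleR)
  qed
  have "act (gK i) (z1 * adj z1 + z2 * adj z2 + z3 * adj z3) = z1 * adj z1 + z2 * adj z2 + z3 * adj z3"
    by (simp add: act_add_right alg_intros K[OF refl])
  then show ?thesis by (simp add: sum_z_adj q_nonzero)
qed

lemma act_Ki_1: "act (gKi i) 1 = 1"
  using act_Ki_weight[OF alg_1, of i 1] by (simp add: act_K_1)

text \<open>The Leibniz rule for \<open>1 * 1\<close> shows that each value equals twice
  itself.\<close>

lemma act_EF_1: "act (gE i) 1 = 0" "act (gF i) 1 = 0"
  using act_E_mult[OF alg_1 alg_1, of i] act_F_mult[OF alg_1 alg_1, of i]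
  by (simp_all add: act_K_1 act_Ki_1)

end

section \<open>Weights\<close>

context quantum_su3
begin

text \<open>The line bundle condition with \<open>K_2\<close> in place of \<open>K_1 K_2^2\<close>,
  since \<open>K_2\<close> is what the coproducts of \<open>E_2\<close> and \<open>F_2\<close>
  contain. Degree N corresponds to \<open>r = q^(N/2)\<close>.\<close>

definition wt :: "real \<Rightarrow> 'c \<Rightarrow> bool" where
  "wt r a \<longleftrightarrow> a \<in> alg \<and> act (gK N1) a = a \<and> act (gE N1) a = 0 \<and> act (gF N1) a = 0 \<and>
     act (gK N2) a = r *\<^sub>R a"

lemma wt_alg: "wt r a \<Longrightarrow> a \<in> alg" by (simp add: wt_def)

lemma wt_Ki: "wt r a \<Longrightarrow> act (gKi N1) a = a"
  using act_Ki_K[of a N1] by (auto simp: wt_def)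

lemma wt_1: "wt 1 1"
  by (simp add: wt_def alg_1 act_K_1 act_EF_1)

lemma wt_0: "wt r 0"
  by (simp add: wt_def alg_0)

lemma wt_mult: "wt r a \<Longrightarrow> wt s b \<Longrightarrow> wt (r * s) (a * b)"
  using wt_Ki[of r a]
  by (auto simp: wt_def alg_mult act_K_mult act_E_mult act_F_mult mult.commute)

lemma wt_scaleR: "wt r a \<Longrightarrow> wt r (c *\<^sub>R a)"
  by (auto simp: wt_def alg_scaleR act_scaleR mult.commute)

lemma wt_power: "wt 1 a \<Longrightarrow> wt 1 (a ^ n)"
  by (induction n) (use wt_mult[of 1 a 1] wt_1 in auto)

definition sq where "sq = q powr (1/2)"

lemma sq: "sq > 0" "sq * sq = q" "sq \<noteq> 0" "q powr (-1/2) = 1 / sq" "sq\<^sup>2 = q"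
  using q_pos by (auto simp: sq_def powr_add[symmetric] powr_minus_divide[symmetric] power2_eq_square)

lemma wt_z: "wt sq (u I3 k)"
  using q_pos by (simp add: wt_def alg_u act_K act_E act_F sq_def)

lemma wt_zs: "wt (1 / sq) (adj (u I3 k))"
proof -
  have "act (gKi N2) (u I3 k) = (1 / sq) *\<^sub>R u I3 k"
    using wt_z[of k] sq by (intro act_Ki_weight) (auto simp: wt_def)
  then show ?thesis
    using wt_z[of k] wt_Ki[OF wt_z[of k]]
    by (auto simp: wt_def alg_u act_K_adj act_E_adj act_F_adj adj_scaleR)
qed

lemma wt_p11_power: "wt 1 (p11 ^ n)"
  using wt_mult[OF wt_zs wt_z, of I1 I1] sq by (intro wt_power) (simp add: pp_def zz_def)

lemma sums_eqI: "f sums a \<Longrightarrow> g sums b \<Longrightarrow> (\<And>n. f n = g n) \<Longrightarrow> a = (b::'c)"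
  using sums_unique2[of f a b] by (metis ext)

text \<open>\<open>act_root\<close> lets the generators act term by term, and every power of
  \<open>p11\<close> has weight 1.\<close>

lemma wt_xroot:
  assumes s: "s \<in> {1/2, -1/2}"
  shows "wt 1 (xr k s)"
proof -
  note a = act_root[OF s, of k]
  have "\<bar>s\<bar> \<le> 1" using s by auto
  note x = xroot_sums[OF this, of k]
  have w: "act (gK N1) (p11 ^ n) = p11 ^ n" "act (gE N1) (p11 ^ n) = 0" "act (gF N1) (p11 ^ n) = 0"
    "act (gK N2) (p11 ^ n) = p11 ^ n" for n
    using wt_p11_power[of n] by (auto simp: wt_def)
  have "act (gK N1) (xr k s) = xr k s" "act (gK N2) (xr k s) = xr k s"
    by (rule sums_eqI[OF a x], simp add: w)+
  moreover have "act (gE N1) (xr k s) = 0" "act (gF N1) (xr k s) = 0"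
    by (rule sums_eqI[OF a sums_zero], simp add: w)+
  ultimately show ?thesis
    using s by (auto simp: wt_def alg_root)
qed

text \<open>The line bundles fix the eigenvalue of \<open>K\<^sub>2\<^sup>2\<close> only. Every element of the enlarged algebra is a sum
  of eigenvectors of \<open>K\<^sub>2\<close> with positive eigenvalues, which excludes the negative square root.\<close>

definition K2_eigen :: "'c set" where
  "K2_eigen = {a \<in> alg. \<exists>r>0. act (gK N2) a = r *\<^sub>R a}"

inductive_set K2_span :: "'c set" where
  K2_span_zero: "0 \<in> K2_span"
| K2_span_add: "a \<in> K2_eigen \<Longrightarrow> b \<in> K2_span \<Longrightarrow> a + b \<in> K2_span"

lemma K2_eigen_alg: "a \<in> K2_eigen \<Longrightarrow> a \<in> alg" by (simp add: K2_eigen_def)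

lemma K2_span_alg: "a \<in> K2_span \<Longrightarrow> a \<in> alg"
  by (induction rule: K2_span.induct) (auto simp: K2_eigen_def alg_intros)

lemma K2_span_eigen: "a \<in> K2_eigen \<Longrightarrow> a \<in> K2_span"
  using K2_span_add[of a 0] K2_span_zero by simp

lemma K2_span_plus: "a \<in> K2_span \<Longrightarrow> b \<in> K2_span \<Longrightarrow> a + b \<in> K2_span"
  by (induction rule: K2_span.induct) (auto intro: K2_span_add simp: add.assoc)

lemma K2_eigen_mult: "a \<in> K2_eigen \<Longrightarrow> b \<in> K2_eigen \<Longrightarrow> a * b \<in> K2_eigen"
  unfolding K2_eigen_def by (auto simp: alg_intros act_K_mult) (metis mult_pos_pos mult.commute)

lemma K2_eigen_scaleC: "a \<in> K2_eigen \<Longrightarrow> scaleC c a \<in> K2_eigen"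
  unfolding K2_eigen_def by (auto simp: alg_intros act_scaleC scaleC_scaleR)

lemma K2_span_mult:
  assumes "a \<in> K2_span" "b \<in> K2_span"
  shows "a * b \<in> K2_span"
  using assms(1)
proof induction
  case (K2_span_add a a')
  have "a * b \<in> K2_span" using assms(2)
    by induction (auto simp: distrib_left K2_span_zero K2_eigen_mult K2_span_add.hyps(1) intro: K2_span.intros)
  with K2_span_add show ?case by (simp add: distrib_right K2_span_plus)
qed (simp add: K2_span_zero)

lemma K2_eigen_gen: "a \<in> K2_eigen \<Longrightarrow> act (fa_gen g) a \<in> K2_eigen"
proof -
  assume "a \<in> K2_eigen"
  then obtain r where a: "a \<in> alg" and r: "r > 0" "act (gK N2) a = r *\<^sub>R a"
    by (auto simp: K2_eigen_def)
  have "\<exists>s>0. act (gK N2) (act (fa_gen g) a) = s *\<^sub>R act (fa_gen g) a"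
  proof (cases g)
    case (UK i)
    have "act (gK N2) (act (gK i) a) = r *\<^sub>R act (gK i) a"
      using a r by (simp add: act_K_K[of a N2 i] act_scaleR)
    with UK r show ?thesis by blast
  next
    case (UKinv i)
    have "act (gK i) (act (gK N2) (act (gKi i) a)) = act (gK N2) (act (gK i) (act (gKi i) a))"
      using a by (simp add: act_K_K alg_intros)
    also have "\<dots> = r *\<^sub>R a" using a r by (simp add: act_K_Ki)
    finally have "act (gKi i) (act (gK i) (act (gK N2) (act (gKi i) a))) = act (gKi i) (r *\<^sub>R a)" by simp
    then have "act (gK N2) (act (gKi i) a) = r *\<^sub>R act (gKi i) a"
      using a by (simp add: act_Ki_K alg_intros act_scaleR)
    with UKinv r show ?thesis by blast
  next
    case (UE i)
    show ?thesis using act_K_E[OF a r(2), of i] KE_coeff_pos[of N2 i] r UE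
      by (metis divide_pos_pos)
  next
    case (UF i)
    show ?thesis using act_K_F[OF a r(2), of i] KE_coeff_pos[of N2 i] r UF
      by (metis mult_pos_pos less_irrefl)
  qed
  with a show ?thesis by (simp add: K2_eigen_def alg_intros)
qed

lemma K2_span_act: "a \<in> K2_span \<Longrightarrow> act x a \<in> K2_span"
proof -
  have word: "act (Poly_Mapping.single (Word ws) 1) a \<in> K2_eigen" if "a \<in> K2_eigen" for a ws
    using that
  proof (induction ws arbitrary: a)
    case Nil
    then show ?case
      using act_1_left[of a] by (simp add: K2_eigen_alg flip: zero_fmon_def)
  next
    case (Cons g ws)
    have "Poly_Mapping.single (Word (g # ws)) 1 = fa_gen g * Poly_Mapping.single (Word ws) 1"
      by (simp add: fa_gen_def falg_word_mult)
    with Cons show ?case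
      by (simp add: act_mult K2_eigen_alg K2_eigen_gen)
  qed
  have eigen: "act x a \<in> K2_span" if a: "a \<in> K2_eigen" for a
  proof (induction x rule: falg_induct)
    case zero
    have "act 0 a = 0" using act_diff_left[of a 0 0] K2_eigen_alg[OF a] by simp
    then show ?case by (simp add: K2_span_zero)
  next
    case (single w c)
    obtain ws where w: "w = Word ws" by (cases w) auto
    show ?case
      using act_word_scale[OF K2_eigen_alg[OF a], of ws c] word[OF a]
      by (simp add: w K2_eigen_scaleC K2_span_eigen)
  next
    case (add f g)
    then show ?case using a by (simp add: act_add_left K2_eigen_alg K2_span_plus)
  qed
  assume "a \<in> K2_span"
  then show ?thesis
    by induction (auto simp: K2_span_zero act_add_right K2_eigen_alg K2_span_alg K2_span_plus eigen)
qed

lemma K2_eigen_u: "u i j \<in> K2_eigen" "adj (u i j) \<in> K2_eigen"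
proof -
  define r where "r = q powr ((of_bool (i = up N2) - of_bool (i = lo N2)) / 2)"
  have r: "r > 0" "act (gK N2) (u i j) = r *\<^sub>R u i j"
    using q_pos by (auto simp: r_def act_K)
  then show "u i j \<in> K2_eigen" by (auto simp: K2_eigen_def alg_u)
  have "act (gK N2) (adj (u i j)) = (1 / r) *\<^sub>R adj (u i j)"
    using r act_Ki_weight[OF alg_u(1) r(2)] by (simp add: act_K_adj alg_u adj_scaleR)
  then show "adj (u i j) \<in> K2_eigen"
    using r(1) by (auto simp: K2_eigen_def alg_u intro!: exI[of _ "1 / r"])
qed

lemma K2_eigen_1: "1 \<in> K2_eigen"
  by (auto simp: K2_eigen_def alg_1 act_K_1 intro!: exI[of _ 1])

lemma K2_span_ueval: "ueval u f \<in> K2_span"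
proof (induction f rule: falg_induct)
  case (single w c)
  obtain ws where w: "w = Word ws" by (cases w) auto
  have "prod_list (map (\<lambda>g. case g of AU i j \<Rightarrow> u i j | AUstar i j \<Rightarrow> adj (u i j)) ws) \<in> K2_eigen"
    by (induction ws) (auto simp: K2_eigen_1 K2_eigen_u split: agen.split intro!: K2_eigen_mult)
  then show ?case
    by (simp add: w ueval_def fa_eval_single K2_eigen_scaleC K2_span_eigen)
qed (auto simp: K2_span_zero ueval_add K2_span_plus)

lemma alg_K2_span: "a \<in> alg \<Longrightarrow> a \<in> K2_span"
proof (induction rule: enlarged.induct)
  case (root s k)
  then show ?case
    using wt_xroot[of s k] by (intro K2_span_eigen) (auto simp: K2_eigen_def wt_def intro!: exI[of _ 1])
qed (auto simp: K2_span_ueval K2_span_plus K2_span_mult K2_span_act)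

text \<open>Induction on the number of summands. With \<open>r\<close> the eigenvalue of the first
  one, \<open>T = K_2 - r\<close> kills it and rescales the others, so the image of the sum has one
  summand fewer. On the whole sum \<open>T\<close> is multiplication by \<open>-c - r\<close>, which
  is nonzero.\<close>

lemma K2_span_negative_eigenvalue:
  assumes "list_all (\<lambda>a. a \<in> K2_eigen) as" "act (gK N2) (sum_list as) = - c *\<^sub>R sum_list as" "c > 0"
  shows "sum_list as = 0"
  using assms
proof (induction "length as" arbitrary: as)
  case (Suc n)
  then obtain a bs where as: "as = a # bs" by (cases as) auto
  define z where "z = sum_list as"
  have alg: "list_all (\<lambda>a. a \<in> alg) bs \<and> list_all (\<lambda>a. a \<in> K2_eigen) bs" "a \<in> K2_eigen"
    using Suc.prems(1) by (auto simp: as list_all_iff K2_eigen_alg)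
  then obtain r where r: "r > 0" "act (gK N2) a = r *\<^sub>R a" "a \<in> alg"
    by (auto simp: K2_eigen_def)
  define T where "T x = act (gK N2) x - r *\<^sub>R x" for x
  have bs: "T (sum_list bs) = sum_list (map T bs) \<and> sum_list bs \<in> alg"
    using alg(1) by (induction bs) (auto simp: T_def alg_intros act_add_right scaleR_add_right)
  have z: "z \<in> alg" using bs r by (simp add: z_def as alg_intros)
  have Tz: "T z = sum_list (map T bs)"
    using bs r by (simp add: z_def as T_def act_add_right scaleR_add_right)
  also have Tz': "T z = (- c - r) *\<^sub>R z"
    using Suc.prems(2) by (simp add: T_def z_def algebra_simps)
  have "T b \<in> K2_eigen" if b: "b \<in> K2_eigen" for b
  proof -
    obtain s where s: "s > 0" "act (gK N2) b = s *\<^sub>R b" "b \<in> alg"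
      using b by (auto simp: K2_eigen_def)
    have Tb: "T b = (s - r) *\<^sub>R b" using s by (simp add: T_def algebra_simps)
    show ?thesis using s unfolding Tb by (auto simp: K2_eigen_def alg_intros act_scaleR mult.commute)
  qed
  then have "list_all (\<lambda>a. a \<in> K2_eigen) (map T bs)"
    using alg by (auto simp: list_all_iff)
  moreover have "act (gK N2) (sum_list (map T bs)) = - c *\<^sub>R sum_list (map T bs)"
    using Suc.prems(2) z unfolding Tz[symmetric] Tz'
    by (simp add: act_scaleR z_def[symmetric] mult.commute)
  ultimately have "T z = 0"
    using Suc.hyps(1)[of "map T bs"] Suc.hyps(2) Suc.prems(3) by (simp add: as Tz)
  then have "z = 0" using Tz' r(1) Suc.prems(3) by simp
  then show ?case by (simp add: z_def)
qed simp

lemma alg_negative_eigenvalue: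
  assumes "a \<in> alg" "act (gK N2) a = - c *\<^sub>R a" "c > 0"
  shows "a = 0"
proof -
  have "\<exists>as. list_all (\<lambda>a. a \<in> K2_eigen) as \<and> b = sum_list as" if "b \<in> K2_span" for b
    using that
  proof induction
    case (K2_span_add a b)
    then obtain as where "list_all (\<lambda>a. a \<in> K2_eigen) as" "b = sum_list as" by blast
    with K2_span_add show ?case by (intro exI[of _ "a # as"]) simp
  qed (auto intro: exI[of _ "[]"])
  from this[OF alg_K2_span[OF assms(1)]] K2_span_negative_eigenvalue assms show ?thesis
    by metis
qed

lemma line_bundle_wt:
  assumes "\<eta> \<in> line_bundle q t u act N"
  shows "wt (q powr (N / 2)) \<eta>"
proof -
  define r where "r = q powr (N / 2)"
  have r: "r > 0" "r * r = q powi N"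
    using q_pos by (simp_all add: r_def powr_add[symmetric] powr_real_of_int')
  have eta: "\<eta> \<in> alg" "act (gK N1) \<eta> = \<eta>" "act (gE N1) \<eta> = 0" "act (gF N1) \<eta> = 0"
    "act (gK N2) (act (gK N2) \<eta>) = (q powi N) *\<^sub>R \<eta>"
    using assms by (auto simp: line_bundle_def act_mult)
  \<comment> \<open>The part of \<open>\<eta>\<close> on which \<open>K_2\<close> would take the
    negative root: \<open>K_2^2 = r^2\<close> on \<open>\<eta>\<close> makes it an eigenvector for
    \<open>-r\<close>.\<close>
  define \<zeta> where "\<zeta> = act (gK N2) \<eta> - r *\<^sub>R \<eta>"
  have "act (gK N2) \<zeta> = - r *\<^sub>R \<zeta>"
    using eta by (simp add: \<zeta>_def act_diff act_scaleR alg_intros scaleR_diff_right r(2))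
  then have "\<zeta> = 0"
    using alg_negative_eigenvalue[of \<zeta> r] r(1) eta by (simp add: \<zeta>_def alg_intros)
  then show ?thesis using eta by (simp add: wt_def \<zeta>_def r_def)
qed

end

section \<open>Partial derivatives\<close>

datatype direction = D1 | D2 | D3 | D4

fun dir_op :: "direction \<Rightarrow> ugen falg" where
  "dir_op D1 = gE N2"
| "dir_op D2 = gE N2 * gE N1"
| "dir_op D3 = gF N2 * gF N1"
| "dir_op D4 = gF N2"

fun holo :: "direction \<Rightarrow> bool" where
  "holo D1 = True" | "holo D2 = True" | "holo D3 = False" | "holo D4 = False"

fun opp :: "direction \<Rightarrow> direction" where
  "opp D1 = D4" | "opp D2 = D3" | "opp D3 = D2" | "opp D4 = D1"

text \<open>The scalar relating \<open>S(x)^*\<close> to the operator of the opposite direction,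
  where \<open>x\<close> is the operator of the given one: \<open>-q\<close> per factor
  \<open>E\<close>, \<open>-1/q\<close> per factor \<open>F\<close>.\<close>

fun star_coeff :: "real \<Rightarrow> direction \<Rightarrow> real" where
  "star_coeff q D1 = - q"
| "star_coeff q D2 = q\<^sup>2"
| "star_coeff q D3 = 1 / q\<^sup>2"
| "star_coeff q D4 = - (1 / q)"

lemma holo_opp [simp]: "holo (opp d) \<longleftrightarrow> \<not> holo d"
  by (cases d) auto

context quantum_su3
begin

definition D :: "direction \<Rightarrow> 'c \<Rightarrow> 'c" where
  "D d = act (dir_op d)"

lemma D_add: "a \<in> alg \<Longrightarrow> b \<in> alg \<Longrightarrow> D d (a + b) = D d a + D d b"
  by (simp add: D_def act_add_right)

lemma D_diff: "a \<in> alg \<Longrightarrow> b \<in> alg \<Longrightarrow> D d (a - b) = D d a - D d b"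
  by (simp add: D_def act_diff)

lemma D_minus: "a \<in> alg \<Longrightarrow> D d (- a) = - D d a"
  by (simp add: D_def act_minus)

lemma D_scaleR: "a \<in> alg \<Longrightarrow> D d (r *\<^sub>R a) = r *\<^sub>R D d a"
  by (simp add: D_def act_scaleR)

lemma D_0 [simp]: "D d 0 = 0"
  by (simp add: D_def)

lemma D_1 [simp]: "D d 1 = 0"
  by (cases d) (simp_all add: D_def act_mult alg_1 act_EF_1)

text \<open>\<open>enlarged\<close> has no rule for \<open>adj\<close>, so membership of
  \<open>adj a\<close> is a hypothesis. The composite operators also require the adjoint of the
  first derivative to lie in \<open>alg\<close>; this comes from \<open>act_E_adj\<close> and
  \<open>act_F_adj\<close>.\<close>

lemma D_adj:
  assumes a: "a \<in> alg" "adj a \<in> alg"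
  shows "D d (adj a) = star_coeff q d *\<^sub>R adj (D (opp d) a)"
proof -
  have "adj (act (gF N2) a) = (- (1 / q)) *\<^sub>R act (gE N2) (adj a)"
    using a q_pos by (simp add: act_E_adj)
  then have F: "adj (act (gF N2) a) \<in> alg"
    using a by (simp add: alg_intros)
  have "adj (act (gE N2) a) = (- q) *\<^sub>R act (gF N2) (adj a)"
    using a q_pos by (simp add: act_F_adj)
  then have E: "adj (act (gE N2) a) \<in> alg"
    using a by (simp add: alg_intros)
  show ?thesis
    using a E F by (cases d)
      (simp_all add: D_def act_mult act_E_adj act_F_adj act_minus act_scaleR alg_intros power2_eq_square)
qed

lemma D_z: "\<not> holo d \<Longrightarrow> D d (u I3 k) = 0"
  by (cases d) (auto simp: D_def act_mult alg_u act_F)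

lemma D_zs: "holo d \<Longrightarrow> D d (adj (u I3 k)) = 0"
  by (cases d) (auto simp: D_def act_mult alg_u act_E_adj act_F)

text \<open>The twist stems from \<open>E_2\<close> or \<open>F_2\<close> alone. A second step by
  \<open>E_1\<close> or \<open>F_1\<close> annihilates \<open>a\<close> and \<open>b\<close>, and
  \<open>K_1\<close> fixes them, so it only reaches the factor already differentiated.\<close>

lemma D_mult:
  assumes a: "wt r a" and b: "wt s b" and r: "r \<noteq> 0"
  shows "D d (a * b) = s *\<^sub>R (D d a * b) + (1 / r) *\<^sub>R (a * D d b)"
proof -
  have Ki: "act (gKi N2) a = (1 / r) *\<^sub>R a"
    using a r by (intro act_Ki_weight) (auto simp: wt_def)
  show ?thesis
    using a b wt_Ki[OF a]
    by (cases d) (simp_all add: D_def wt_def Ki act_mult act_E_mult act_F_mult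
        act_add_right act_scaleR alg_intros)
qed

lemmas D_mult_1 = D_mult[where r=1, simplified]

lemma sum_z_D_zs: "z1 * D d (adj z1) + z2 * D d (adj z2) + z3 * D d (adj z3) = 0"
proof (cases "holo d")
  case False
  have "0 = D d (z1 * adj z1 + z2 * adj z2 + z3 * adj z3)"
    by (simp add: sum_z_adj[OF q_nonzero])
  also have "\<dots> = (1 / sq) *\<^sub>R (z1 * D d (adj z1) + z2 * D d (adj z2) + z3 * D d (adj z3))"
    using False by (simp add: D_add alg_intros D_mult[OF wt_z wt_zs] sq D_z scaleR_add_right)
  finally show ?thesis using sq by simp
qed (simp add: D_zs)

lemma weighted_sum_zs_D_z:
  "q ^ 4 *\<^sub>R (adj z1 * D d z1) + q\<^sup>2 *\<^sub>R (adj z2 * D d z2) + adj z3 * D d z3 = 0"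
proof (cases "holo d")
  case True
  have "0 = D d (q ^ 4 *\<^sub>R (adj z1 * z1) + q\<^sup>2 *\<^sub>R (adj z2 * z2) + adj z3 * z3)"
    by (simp add: weighted_sum_adj_z[OF q_nonzero])
  also have "\<dots> = sq *\<^sub>R (q ^ 4 *\<^sub>R (adj z1 * D d z1) + q\<^sup>2 *\<^sub>R (adj z2 * D d z2) + adj z3 * D d z3)"
    using True by (simp add: D_add D_scaleR alg_intros D_mult[OF wt_zs wt_z] sq D_zs scaleR_add_right mult.commute)
  finally show ?thesis using sq by simp
qed (simp add: D_z)

text \<open>Leibniz rule for \<open>z_2 z_3 = q z_3 z_2\<close>. It is used to pass from derivatives
  on the left, as in the form \<open>\<phi>\<close>, to derivatives on the right, as in
  \<open>psi_D_phi\<close>.\<close>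

lemma D_z_commute:
  "q *\<^sub>R (D d z2 * z3) + z2 * D d z3 = (q\<^sup>2) *\<^sub>R (D d z3 * z2) + q *\<^sub>R (z3 * D d z2)"
proof -
  have "sq *\<^sub>R D d (z2 * z3) = sq *\<^sub>R (q *\<^sub>R D d (z3 * z2))"
    by (simp add: z_commute(3) D_scaleR alg_intros)
  moreover have "sq * (q * sq) = q\<^sup>2"
    using sq(2) by (simp add: power2_eq_square mult.left_commute)
  ultimately show ?thesis
    using sq by (simp add: D_mult[OF wt_z wt_z] scaleR_add_right)
qed

text \<open>The same exchange for the adjoints: derivatives stand on the left in the adjoint of the
  form \<open>\<Phi>\<close>, on the right in \<open>phi_D_psi\<close>.\<close>

lemma D_zs_commute:
  "(1 / q) *\<^sub>R (D d (adj z3) * adj z2) - D d (adj z2) * adj z3 = q *\<^sub>R (adj z2 * D d (adj z3)) - adj z3 * D d (adj z2)"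
proof -
  have c: "adj z3 * adj z2 = q *\<^sub>R (adj z2 * adj z3)"
    using arg_cong[OF z_commute(3), of adj] by (simp add: adj_mult adj_scaleR)
  have "(1 / sq) *\<^sub>R D d (adj z3 * adj z2) = (1 / sq) *\<^sub>R (q *\<^sub>R D d (adj z2 * adj z3))"
    by (simp add: c D_scaleR alg_intros)
  then have "(1 / q) *\<^sub>R (D d (adj z3) * adj z2) + adj z3 * D d (adj z2)
     = D d (adj z2) * adj z3 + q *\<^sub>R (adj z2 * D d (adj z3))"
    using sq(1) q_pos by (simp add: D_mult[OF wt_zs wt_zs] sq scaleR_add_right mult.left_commute)
  then show ?thesis by (simp add: algebra_simps)
qed

lemma z_D_zs_p11: "\<not> holo d \<Longrightarrow> z1 * D d (adj z1) = sq *\<^sub>R D d p11"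
  using sq by (simp add: p11_eq(2) D_mult[OF wt_z wt_zs] D_z)

lemma zs_D_z_p11: "holo d \<Longrightarrow> adj z1 * D d z1 = (1 / sq) *\<^sub>R D d p11"
  using sq by (simp add: p11_eq(1) D_mult[OF wt_zs wt_z] D_zs)

lemma D_square_root:
  fixes k :: nat
  defines "h \<equiv> xr k (1/2)" and "f \<equiv> xr k (-1/2)"
  shows "(t\<^sup>2 * q ^ k) *\<^sub>R (f * D d p11 * f) = h * D d f + D d f * h"
proof -
  note c = xroot_cancel[of k, folded h_def f_def]
  have w: "wt 1 h" "wt 1 f" unfolding h_def f_def by (rule wt_xroot; simp)+
  have w2: "wt 1 (h * h)" "wt 1 (f * f)" using wt_mult[OF w(1) w(1)] wt_mult[OF w(2) w(2)] by simp_all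
  note al = w[THEN wt_alg] w2[THEN wt_alg]
  have hh: "D d (h * h) = - ((t\<^sup>2 * q ^ k) *\<^sub>R D d p11)"
    unfolding c(3) using wt_p11_power[of 1] by (simp add: D_diff D_scaleR alg_intros wt_alg)
  have r: "h * (f * a) = a" "f * (h * a) = a" for a
    by (simp_all add: c(1,2) mult.assoc[symmetric])
  have "(h * h) * (f * f) = 1" by (simp only: mult.assoc r c(1))
  then have "0 = D d ((h * h) * (f * f))" by simp
  also have "\<dots> = D d (h * h) * (f * f) + h * h * (D d f * f + f * D d f)"
    by (simp add: D_mult_1[OF w2] D_mult_1[OF w(2) w(2)])
  finally have "f * (D d (h * h) * (f * f) + h * h * (D d f * f + f * D d f)) * h = 0"
    by simp
  then have "f * D d (h * h) * f + h * D d f + D d f * h = 0"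
    by (simp add: distrib_left distrib_right mult.assoc add.assoc r c(1,2))
  then show ?thesis by (simp add: hh algebra_simps)
qed

end

section \<open>The Grassmannian connections\<close>

text \<open>The coefficients \<open>w\<close> are normalised so that those of \<open>d a\<close> are the images of \<open>a\<close> under the action.\<close>

definition form_of :: "real \<Rightarrow> (direction \<Rightarrow> 'c) \<Rightarrow> 'c::cstar_algebra form" where
  "form_of q w =
     ((scaleC (\<i> * complex_of_real (q powr (-3/2))) (w D1),
       scaleC (\<i> * complex_of_real (q powr (-3/2))) (w D2)),
      (scaleC \<i> (w D3), scaleC \<i> (w D4)))"

lemma form_of_add: "form_of q v + form_of q w = form_of q (\<lambda>d. v d + w d)"
  by (simp add: form_of_def scaleC_add_right)

lemma form_of_diff: "form_of q v - form_of q w = form_of q (\<lambda>d. v d - w d)"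
  by (simp add: form_of_def scaleC_diff_right)

lemma form_of_minus: "- form_of q v = form_of q (\<lambda>d. - v d)"
  by (simp add: form_of_def scaleC_minus_right)

lemma form_of_scaleR: "r *\<^sub>R form_of q v = form_of q (\<lambda>d. r *\<^sub>R v d)"
  by (simp add: form_of_def scaleC_scaleR)

lemma form_of_lmul: "a \<cdot>\<^sub>l form_of q v = form_of q (\<lambda>d. a * v d)"
  by (simp add: form_of_def lmul_def form_map_def mult_scaleC_right)

lemma form_of_rmul: "form_of q v \<cdot>\<^sub>r a = form_of q (\<lambda>d. v d * a)"
  by (simp add: form_of_def rmul_def form_map_def mult_scaleC_left)

lemma form_of_0: "form_of q (\<lambda>d. 0) = 0"
  by (simp add: form_of_def zero_prod_def)

lemma form_of_sum_list:
  "(\<Sum>x\<leftarrow>xs. form_of q (w x)) = form_of q (\<lambda>d. \<Sum>x\<leftarrow>xs. w x d)"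
  by (induction xs) (auto simp: form_of_0 form_of_add)

lemma form_of_sum:
  "(\<Sum>x\<in>X. form_of q (w x)) = form_of q (\<lambda>d. \<Sum>x\<in>X. w x d)"
  by (induction X rule: infinite_finite_induct) (auto simp: form_of_0 form_of_add)

lemma scaleC_imaginary:
  "scaleC (\<i> * complex_of_real r) a = r *\<^sub>R scaleC \<i> (a::'c::cstar_algebra)"
  by (simp add: scaleC_scaleC[symmetric] scaleC_of_real scaleC_scaleR)

lemma adj_scaleC_imaginary: "adj (scaleC \<i> a) = - scaleC \<i> (adj (a::'c::cstar_algebra))"
  by (simp add: adj_scaleC scaleC_minus_left)

text \<open>The normalising constants of \<open>form_of\<close> absorb the half powers of q in
  \<open>form_star\<close>. What remains are the coefficients of \<open>D_adj\<close>, which is the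
  reality condition of the differential.\<close>

lemma form_of_star:
  assumes "0 < q"
  shows "form_star q (form_of q w) = form_of q (\<lambda>d. star_coeff q d *\<^sub>R adj (w (opp d)))"
proof -
  define s where "s = q powr (1/2)"
  have s: "s > 0" "s * s = q" using assms by (auto simp: s_def powr_add[symmetric])
  have p: "q powr (-1/2) = 1 / s" "q powr (-3/2) = 1 / (s * q)"
    using assms powr_add[of q "-1/2" "-1"] powr_minus_divide[of q "1/2"] powr_minus_divide[of q 1]
    by (simp_all add: s_def)
  show ?thesis
    unfolding form_of_def form_star.simps scaleC_imaginary p s_def[symmetric] star_coeff.simps opp.simps
      adj_scaleR adj_scaleC_imaginary scaleC_scaleR
    unfolding s(2)[symmetric]
    using s(1) by (simp add: power2_eq_square)
qed

context quantum_su3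
begin

abbreviation fo where "fo \<equiv> form_of q"

lemma dd_form_of: "dd q act a = fo (\<lambda>d. D d a)"
  by (simp add: dd_def del_form_def delbar_form_def form_of_def D_def)

lemma del_form_of: "del_form q act a = fo (\<lambda>d. if holo d then D d a else 0)"
  by (simp add: del_form_def form_of_def D_def)

lemma delbar_form_of: "delbar_form act a = fo (\<lambda>d. if holo d then 0 else D d a)"
  by (simp add: delbar_form_def form_of_def D_def)

lemma wt_minus: "wt r a \<Longrightarrow> wt r (- a)"
  using wt_scaleR[of r a "-1"] by simp

text \<open>A triple holds the entry \<open>c\<close> of the column paired from the left and the
  entries \<open>a\<close>, \<open>b\<close> of the two columns in the same row. The weights of
  \<open>a\<close> and \<open>\<eta>1\<close> are reciprocal, so both Leibniz terms carry the same
  factor \<open>sq\<close>; likewise \<open>1 / sq\<close> for \<open>b\<close> and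
  \<open>\<eta>2\<close>. Only four pairings of columns are left to compute.\<close>

lemma rows_sum:
  assumes L: "\<forall>(c, a, b)\<in>set L. wt (1 / sq) a \<and> wt sq b"
    and f: "wt 1 f" and g: "wt 1 g" and e: "wt sq \<eta>1" "wt (1 / sq) \<eta>2" and k: "adj k = k"
  shows "(\<Sum>(c, a, b)\<leftarrow>L. adj (c * k) * D d (a * f * \<eta>1 + b * g * \<eta>2)) =
     sq *\<^sub>R (k * (\<Sum>(c, a, b)\<leftarrow>L. adj c * D d a) * (f * \<eta>1))
   + sq *\<^sub>R (k * (\<Sum>(c, a, b)\<leftarrow>L. adj c * a) * D d (f * \<eta>1))
   + (1 / sq) *\<^sub>R (k * (\<Sum>(c, a, b)\<leftarrow>L. adj c * D d b) * (g * \<eta>2))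
   + (1 / sq) *\<^sub>R (k * (\<Sum>(c, a, b)\<leftarrow>L. adj c * b) * D d (g * \<eta>2))"
  using L
proof (induction L)
  case (Cons x L)
  obtain c a b where x: "x = (c, a, b)" by (cases x)
  have w: "wt (1 / sq) a" "wt sq b" using Cons.prems by (auto simp: x)
  have w1: "wt sq (f * \<eta>1)" "wt (1 / sq) (g * \<eta>2)"
    using wt_mult[OF f e(1)] wt_mult[OF g e(2)] by simp_all
  have al: "a * (f * \<eta>1) \<in> alg" "b * (g * \<eta>2) \<in> alg"
    using w w1 by (auto intro!: alg_mult dest!: wt_alg)
  have "D d (a * f * \<eta>1 + b * g * \<eta>2) = sq *\<^sub>R (D d a * (f * \<eta>1)) + sq *\<^sub>R (a * D d (f * \<eta>1))
     + ((1 / sq) *\<^sub>R (D d b * (g * \<eta>2)) + (1 / sq) *\<^sub>R (b * D d (g * \<eta>2)))"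
    using al sq by (simp add: mult.assoc D_add D_mult[OF w(1) w1(1)] D_mult[OF w(2) w1(2)])
  then show ?case
    using Cons by (simp add: x adj_mult k algebra_simps)
qed simp

context
  fixes \<theta> :: real
  assumes t_sin: "t = sin (2 * \<theta>)"
begin

lemma trig: "cos (2 * \<theta>) * cos (2 * \<theta>) = 1 - t\<^sup>2" "cos \<theta> * cos \<theta> + sin \<theta> * sin \<theta> = 1"
  "2 * (sin \<theta> * cos \<theta>) = t"
proof -
  show "cos (2 * \<theta>) * cos (2 * \<theta>) = 1 - t\<^sup>2"
    unfolding t_sin using sin_cos_squared_add[of "2 * \<theta>"] by (simp add: power2_eq_square)
  show "cos \<theta> * cos \<theta> + sin \<theta> * sin \<theta> = 1"
    using sin_cos_squared_add[of \<theta>] by (simp add: power2_eq_square)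
  show "2 * (sin \<theta> * cos \<theta>) = t"
    by (simp add: t_sin sin_double)
qed

section \<open>Pairings of the columns \<open>psi\<close> and \<open>phi\<close> with each other and
  with their derivatives\<close>

abbreviation psi where "psi \<equiv> psi_col \<theta> u"
abbreviation phi where "phi \<equiv> phi_col q \<theta> u"

lemmas expand_cols = psi_col_def phi_col_def zz_def D_scaleR D_minus alg_intros adj_scaleR adj_minus adj_adj

text \<open>The sum differs from that of \<open>Psi_1\<close>, which vanishes, only in the weight
  \<open>1 - t^2\<close> of the first entry.\<close>

lemma psi_D_psi: "(\<Sum>(a, b)\<leftarrow>zip psi psi. adj a * D d b) = - (t\<^sup>2 *\<^sub>R (z1 * D d (adj z1)))"
proof -
  have "(\<Sum>(a, b)\<leftarrow>zip psi psi. adj a * D d b)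
     = (cos (2 * \<theta>) * cos (2 * \<theta>)) *\<^sub>R (z1 * D d (adj z1))
     + (cos \<theta> * cos \<theta> + sin \<theta> * sin \<theta>) *\<^sub>R (z2 * D d (adj z2))
     + (cos \<theta> * cos \<theta> + sin \<theta> * sin \<theta>) *\<^sub>R (z3 * D d (adj z3))"
    unfolding scaleR_add_left by (simp add: expand_cols)
  also have "\<dots> = (z1 * D d (adj z1) + z2 * D d (adj z2) + z3 * D d (adj z3)) - t\<^sup>2 *\<^sub>R (z1 * D d (adj z1))"
    unfolding trig by (simp add: scaleR_diff_left)
  finally show ?thesis by (simp add: sum_z_D_zs)
qed

lemma psi_psi: "(\<Sum>(a, b)\<leftarrow>zip psi psi. adj a * b) = 1 - t\<^sup>2 *\<^sub>R p11"
proof -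
  have "(\<Sum>(a, b)\<leftarrow>zip psi psi. adj a * b)
     = (cos (2 * \<theta>) * cos (2 * \<theta>)) *\<^sub>R (z1 * adj z1)
     + (cos \<theta> * cos \<theta> + sin \<theta> * sin \<theta>) *\<^sub>R (z2 * adj z2)
     + (cos \<theta> * cos \<theta> + sin \<theta> * sin \<theta>) *\<^sub>R (z3 * adj z3)"
    unfolding scaleR_add_left by (simp add: expand_cols)
  also have "\<dots> = (z1 * adj z1 + z2 * adj z2 + z3 * adj z3) - t\<^sup>2 *\<^sub>R (z1 * adj z1)"
    unfolding trig by (simp add: scaleR_diff_left)
  finally show ?thesis by (simp add: sum_z_adj[OF q_nonzero] p11_eq(2))
qed

lemma phi_D_phi: "(\<Sum>(a, b)\<leftarrow>zip phi phi. adj a * D d b) = - ((t\<^sup>2 * q ^ 4) *\<^sub>R (adj z1 * D d z1))"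
proof -
  have "(\<Sum>(a, b)\<leftarrow>zip phi phi. adj a * D d b)
     = (cos (2 * \<theta>) * cos (2 * \<theta>)) *\<^sub>R q ^ 4 *\<^sub>R (adj z1 * D d z1)
     + (cos \<theta> * cos \<theta> + sin \<theta> * sin \<theta>) *\<^sub>R q\<^sup>2 *\<^sub>R (adj z2 * D d z2)
     + (cos \<theta> * cos \<theta> + sin \<theta> * sin \<theta>) *\<^sub>R (adj z3 * D d z3)"
    unfolding scaleR_add_left by (simp add: expand_cols power2_eq_square power4_eq_xxxx ac_simps)
  also have "\<dots> = (q ^ 4 *\<^sub>R (adj z1 * D d z1) + q\<^sup>2 *\<^sub>R (adj z2 * D d z2) + adj z3 * D d z3)
     - (t\<^sup>2 * q ^ 4) *\<^sub>R (adj z1 * D d z1)"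
    unfolding trig by (simp add: scaleR_diff_left left_diff_distrib)
  finally show ?thesis by (simp add: weighted_sum_zs_D_z)
qed

lemma phi_phi: "(\<Sum>(a, b)\<leftarrow>zip phi phi. adj a * b) = 1 - (t\<^sup>2 * q ^ 4) *\<^sub>R p11"
proof -
  have "(\<Sum>(a, b)\<leftarrow>zip phi phi. adj a * b)
     = (cos (2 * \<theta>) * cos (2 * \<theta>)) *\<^sub>R q ^ 4 *\<^sub>R (adj z1 * z1)
     + (cos \<theta> * cos \<theta> + sin \<theta> * sin \<theta>) *\<^sub>R q\<^sup>2 *\<^sub>R (adj z2 * z2)
     + (cos \<theta> * cos \<theta> + sin \<theta> * sin \<theta>) *\<^sub>R (adj z3 * z3)"
    unfolding scaleR_add_left by (simp add: expand_cols power2_eq_square power4_eq_xxxx ac_simps)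
  also have "\<dots> = (q ^ 4 *\<^sub>R (adj z1 * z1) + q\<^sup>2 *\<^sub>R (adj z2 * z2) + adj z3 * z3)
     - (t\<^sup>2 * q ^ 4) *\<^sub>R (adj z1 * z1)"
    unfolding trig by (simp add: scaleR_diff_left left_diff_distrib)
  finally show ?thesis by (simp add: weighted_sum_adj_z[OF q_nonzero] p11_eq(1))
qed

lemma psi_D_phi: "(\<Sum>(a, b)\<leftarrow>zip psi phi. adj a * D d b) = t *\<^sub>R (q *\<^sub>R (z3 * D d z2) - z2 * D d z3)"
proof -
  have "(\<Sum>(a, b)\<leftarrow>zip psi phi. adj a * D d b)
     = (2 * (sin \<theta> * cos \<theta>)) *\<^sub>R (q *\<^sub>R (z3 * D d z2) - z2 * D d z3)"
    by (simp add: expand_cols algebra_simps flip: scaleR_2)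
  then show ?thesis by (simp only: trig)
qed

text \<open>Orthogonality, by \<open>z_2 z_3 = q z_3 z_2\<close>, removes the derivative of the
  second component from the first row.\<close>

lemma psi_phi: "(\<Sum>(a, b)\<leftarrow>zip psi phi. adj a * b) = 0"
  by (simp add: expand_cols z_commute algebra_simps)

lemma phi_D_psi: "(\<Sum>(a, b)\<leftarrow>zip phi psi. adj a * D d b)
   = t *\<^sub>R (q *\<^sub>R (adj z2 * D d (adj z3)) - adj z3 * D d (adj z2))"
proof -
  have "(\<Sum>(a, b)\<leftarrow>zip phi psi. adj a * D d b)
     = (2 * (sin \<theta> * cos \<theta>)) *\<^sub>R (q *\<^sub>R (adj z2 * D d (adj z3)) - adj z3 * D d (adj z2))"
    by (simp add: expand_cols algebra_simps flip: scaleR_2)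
  then show ?thesis by (simp only: trig)
qed

lemma phi_psi: "(\<Sum>(a, b)\<leftarrow>zip phi psi. adj a * b) = 0"
proof -
  have "adj z3 * adj z2 = q *\<^sub>R (adj z2 * adj z3)"
    using arg_cong[OF z_commute(3), of adj] by (simp add: adj_mult adj_scaleR)
  then show ?thesis
    by (simp add: expand_cols algebra_simps)
qed

end

lemma wt_line_bundle: "wt r a \<Longrightarrow> r * r = q powi N \<Longrightarrow> a \<in> line_bundle q t u act N"
  by (simp add: wt_def line_bundle_def act_mult act_scaleR alg_intros)

lemma z_line_bundle: "u I3 k \<in> line_bundle q t u act 1" "adj (u I3 k) \<in> line_bundle q t u act (-1)"
proof -
  have "(1 / sq) * (1 / sq) = q powi (-1)"
    by (simp add: power_int_minus sq(2) inverse_eq_divide)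
  from wt_line_bundle[OF wt_zs this] show "adj (u I3 k) \<in> line_bundle q t u act (-1)" .
  show "u I3 k \<in> line_bundle q t u act 1"
    using wt_line_bundle[OF wt_z, of 1] sq(2) by simp
qed

section \<open>The four entries of the connection form, direction by direction\<close>

definition xsqrt where "xsqrt k = xr k (1/2)"
definition xinv where "xinv k = xr k (-1/2)"

lemmas xsqrt_cancel = xroot_cancel[folded xsqrt_def xinv_def]
lemmas D_xinv = D_square_root[folded xsqrt_def xinv_def]

abbreviation "f0 \<equiv> xinv 0"
abbreviation "h0 \<equiv> xsqrt 0"
abbreviation "f4 \<equiv> xinv 4"
abbreviation "h4 \<equiv> xsqrt 4"

definition conn_11 :: "direction \<Rightarrow> 'c" where
  "conn_11 d = (if holo d then q *\<^sub>R (h0 * D d f0) else - (q *\<^sub>R (D d f0 * h0)))"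

text \<open>No case split on the type: by \<open>D_z\<close> the value is zero in the directions of
  type (0,1).\<close>

definition conn_12 :: "direction \<Rightarrow> 'c" where
  "conn_12 d = (t / sq) *\<^sub>R (f0 * (q *\<^sub>R (z3 * D d z2) - z2 * D d z3) * f4)"

definition conn_21 :: "direction \<Rightarrow> 'c" where
  "conn_21 d = (sq * t) *\<^sub>R (f4 * (q *\<^sub>R (adj z2 * D d (adj z3)) - adj z3 * D d (adj z2)) * f0)"

definition conn_22 :: "direction \<Rightarrow> 'c" where
  "conn_22 d = (if holo d then - ((1 / q) *\<^sub>R (D d f4 * h4)) else (1 / q) *\<^sub>R (h4 * D d f4))"

lemma wt_roots: "wt 1 (xinv k)" "wt 1 (xsqrt k)"
  unfolding xinv_def xsqrt_def by (rule wt_xroot; simp)+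

lemma adj_roots: "adj (xinv k) = xinv k" "adj (xsqrt k) = xsqrt k"
  unfolding xinv_def xsqrt_def by (rule adj_xroot; simp)+

lemma grassmann_diagonal_1:
  assumes e: "wt sq \<eta>"
  shows "sq *\<^sub>R (f0 * - (t\<^sup>2 *\<^sub>R (z1 * D d (adj z1))) * (f0 * \<eta>)) + sq *\<^sub>R (f0 * (1 - t\<^sup>2 *\<^sub>R p11) * D d (f0 * \<eta>))
     = sq *\<^sub>R D d \<eta> + conn_11 d * \<eta>"
proof -
  have h: "1 - t\<^sup>2 *\<^sub>R p11 = h0 * h0" using xsqrt_cancel(3)[of 0] by simp
  have c: "f0 * h0 = 1" "h0 * f0 = 1" by (rule xsqrt_cancel)+
  have r: "f0 * (h0 * a) = a" "h0 * (f0 * a) = a" for a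
    by (simp_all only: c mult.assoc[symmetric] mult_1_left)
  have De: "D d (f0 * \<eta>) = sq *\<^sub>R (D d f0 * \<eta>) + f0 * D d \<eta>"
    using D_mult_1[OF wt_roots(1) e] by simp
  have 1: "sq *\<^sub>R (f0 * (1 - t\<^sup>2 *\<^sub>R p11) * D d (f0 * \<eta>)) = q *\<^sub>R (h0 * D d f0 * \<eta>) + sq *\<^sub>R D d \<eta>"
    unfolding h De by (simp add: mult.assoc r distrib_left scaleR_add_right sq(2))
  show ?thesis
  proof (cases "holo d")
    case True
    then show ?thesis unfolding 1 by (simp add: D_zs conn_11_def mult.assoc)
  next
    case False
    have "sq *\<^sub>R (f0 * - (t\<^sup>2 *\<^sub>R (z1 * D d (adj z1))) * (f0 * \<eta>))
      = - ((sq * sq) *\<^sub>R (((t\<^sup>2 * q ^ 0) *\<^sub>R (f0 * D d p11 * f0)) * \<eta>))"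
      by (simp add: z_D_zs_p11[OF False] mult.assoc mult.left_commute del: sq)
    \<comment> \<open>The half with \<open>h0 * D d f0\<close> cancels the first term of fact
      \<open>1\<close>; the other half is the component of \<open>-A\<close>.\<close>
    also have "\<dots> = - (q *\<^sub>R ((h0 * D d f0 + D d f0 * h0) * \<eta>))"
      by (simp only: D_xinv sq(2))
    finally show ?thesis unfolding 1 using False
      by (simp add: conn_11_def algebra_simps)
  qed
qed

lemma grassmann_diagonal_2:
  assumes e: "wt (1 / sq) \<eta>"
  shows "(1 / sq) *\<^sub>R (f4 * - ((t\<^sup>2 * q ^ 4) *\<^sub>R (adj z1 * D d z1)) * (f4 * \<eta>))
       + (1 / sq) *\<^sub>R (f4 * (1 - (t\<^sup>2 * q ^ 4) *\<^sub>R p11) * D d (f4 * \<eta>))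
     = (1 / sq) *\<^sub>R D d \<eta> + conn_22 d * \<eta>"
proof -
  have h: "1 - (t\<^sup>2 * q ^ 4) *\<^sub>R p11 = h4 * h4" using xsqrt_cancel(3)[of 4] by simp
  have c: "f4 * h4 = 1" "h4 * f4 = 1" by (rule xsqrt_cancel)+
  have r: "f4 * (h4 * a) = a" "h4 * (f4 * a) = a" for a
    by (simp_all only: c mult.assoc[symmetric] mult_1_left)
  have De: "D d (f4 * \<eta>) = (1 / sq) *\<^sub>R (D d f4 * \<eta>) + f4 * D d \<eta>"
    using D_mult_1[OF wt_roots(1) e] by simp
  have 1: "(1 / sq) *\<^sub>R (f4 * (1 - (t\<^sup>2 * q ^ 4) *\<^sub>R p11) * D d (f4 * \<eta>))
      = (1 / q) *\<^sub>R (h4 * D d f4 * \<eta>) + (1 / sq) *\<^sub>R D d \<eta>"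
    unfolding h De by (simp add: mult.assoc r distrib_left scaleR_add_right sq(2))
  show ?thesis
  proof (cases "holo d")
    case False
    then show ?thesis unfolding 1 by (simp add: D_z conn_22_def mult.assoc)
  next
    case True
    have "(1 / sq) *\<^sub>R (f4 * - ((t\<^sup>2 * q ^ 4) *\<^sub>R (adj z1 * D d z1)) * (f4 * \<eta>))
      = - ((1 / (sq * sq)) *\<^sub>R (((t\<^sup>2 * q ^ 4) *\<^sub>R (f4 * D d p11 * f4)) * \<eta>))"
      by (simp add: zs_D_z_p11[OF True] mult.assoc mult.left_commute)
    also have "\<dots> = - ((1 / q) *\<^sub>R ((h4 * D d f4 + D d f4 * h4) * \<eta>))"
      by (simp only: D_xinv sq(2))
    finally show ?thesis unfolding 1 using True
      by (simp add: conn_22_def algebra_simps)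
  qed
qed

text \<open>The derivative of \<open>\<eta>\<close> has the same factor \<open>sq\<close> as in
  \<open>grassmann_diagonal_1\<close>, so it drops out of the difference of the connections and only
  left multiplication remains.\<close>

lemma monopole_plus:
  assumes e: "wt sq \<eta>"
  shows "(\<Sum>a\<leftarrow>Psi_1 u. adj a * D d (a * \<eta>)) = sq *\<^sub>R D d \<eta>"
proof -
  have "(\<Sum>a\<leftarrow>Psi_1 u. adj a * D d (a * \<eta>))
     = sq *\<^sub>R ((z1 * D d (adj z1) + z2 * D d (adj z2) + z3 * D d (adj z3)) * \<eta>)
     + sq *\<^sub>R ((z1 * adj z1 + z2 * adj z2 + z3 * adj z3) * D d \<eta>)"
    using sq by (simp add: Psi_1_def zz_def adj_adj D_mult[OF wt_zs e] algebra_simps)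
  then show ?thesis by (simp add: sum_z_D_zs sum_z_adj[OF q_nonzero])
qed

lemma monopole_minus:
  assumes e: "wt (1 / sq) \<eta>"
  shows "(\<Sum>a\<leftarrow>Psi_m1 q u. adj a * D d (a * \<eta>)) = (1 / sq) *\<^sub>R D d \<eta>"
proof -
  have "(\<Sum>a\<leftarrow>Psi_m1 q u. adj a * D d (a * \<eta>))
     = (1 / sq) *\<^sub>R ((q ^ 4 *\<^sub>R (adj z1 * D d z1) + q\<^sup>2 *\<^sub>R (adj z2 * D d z2) + adj z3 * D d z3) * \<eta>)
     + (1 / sq) *\<^sub>R ((q ^ 4 *\<^sub>R (adj z1 * z1) + q\<^sup>2 *\<^sub>R (adj z2 * z2) + adj z3 * z3) * D d \<eta>)"
    using sq wt_alg[OF e]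
    by (simp add: Psi_m1_def zz_def adj_scaleR D_scaleR alg_intros D_mult[OF wt_z e] algebra_simps
        power2_eq_square power4_eq_xxxx)
  then show ?thesis by (simp add: weighted_sum_zs_D_z weighted_sum_adj_z[OF q_nonzero])
qed

context
  fixes \<theta> :: real
  assumes t_sin: "t = sin (2 * \<theta>)"
begin

lemma grassmann_row_1:
  assumes e: "wt sq \<eta>1" "wt (1 / sq) \<eta>2"
  shows "(\<Sum>(c, a, b)\<leftarrow>zip (psi_col \<theta> u) (zip (psi_col \<theta> u) (phi_col q \<theta> u)).
           adj (c * f0) * D d (a * f0 * \<eta>1 + b * f4 * \<eta>2))
       = (\<Sum>a\<leftarrow>Psi_1 u. adj a * D d (a * \<eta>1)) + (conn_11 d * \<eta>1 + conn_12 d * \<eta>2)"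
proof -
  let ?psi = "psi_col \<theta> u" and ?phi = "phi_col q \<theta> u"
  let ?L = "zip ?psi (zip ?psi ?phi)"
  have s: "(\<Sum>(c, a, b)\<leftarrow>?L. adj c * F a) = (\<Sum>(a, b)\<leftarrow>zip ?psi ?psi. adj a * F b)"
     "(\<Sum>(c, a, b)\<leftarrow>?L. adj c * F b) = (\<Sum>(a, b)\<leftarrow>zip ?psi ?phi. adj a * F b)" for F
    by (simp_all add: psi_col_def phi_col_def)
  note s0 = s[of "\<lambda>x. x"] s[of "D d"]
  have L: "\<forall>(c, a, b)\<in>set ?L. wt (1 / sq) a \<and> wt sq b"
    by (simp add: psi_col_def phi_col_def zz_def wt_scaleR wt_zs wt_z wt_minus wt_0)
  show ?thesis
    unfolding rows_sum[OF L wt_roots(1) wt_roots(1) e adj_roots(1)] s0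
      psi_D_psi[OF t_sin] psi_psi[OF t_sin] psi_D_phi[OF t_sin] psi_phi[OF t_sin]
      grassmann_diagonal_1[OF e(1)] monopole_plus[OF e(1)]
    by (simp add: conn_12_def mult.assoc)
qed

lemma grassmann_row_2:
  assumes e: "wt sq \<eta>1" "wt (1 / sq) \<eta>2"
  shows "(\<Sum>(c, a, b)\<leftarrow>zip (phi_col q \<theta> u) (zip (psi_col \<theta> u) (phi_col q \<theta> u)).
           adj (c * f4) * D d (a * f0 * \<eta>1 + b * f4 * \<eta>2))
       = (\<Sum>a\<leftarrow>Psi_m1 q u. adj a * D d (a * \<eta>2)) + (conn_21 d * \<eta>1 + conn_22 d * \<eta>2)"
proof -
  let ?psi = "psi_col \<theta> u" and ?phi = "phi_col q \<theta> u"
  let ?L = "zip ?phi (zip ?psi ?phi)"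
  have s: "(\<Sum>(c, a, b)\<leftarrow>?L. adj c * F a) = (\<Sum>(a, b)\<leftarrow>zip ?phi ?psi. adj a * F b)"
     "(\<Sum>(c, a, b)\<leftarrow>?L. adj c * F b) = (\<Sum>(a, b)\<leftarrow>zip ?phi ?phi. adj a * F b)" for F
    by (simp_all add: psi_col_def phi_col_def)
  note s0 = s[of "\<lambda>x. x"] s[of "D d"]
  have L: "\<forall>(c, a, b)\<in>set ?L. wt (1 / sq) a \<and> wt sq b"
    by (simp add: psi_col_def phi_col_def zz_def wt_scaleR wt_zs wt_z wt_minus wt_0)
  show ?thesis
    unfolding rows_sum[OF L wt_roots(1) wt_roots(1) e adj_roots(1)] s0
      phi_D_psi[OF t_sin] phi_psi[OF t_sin] phi_D_phi[OF t_sin] phi_phi[OF t_sin] monopole_minus[OF e(2)]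
    by (simp only: add.assoc grassmann_diagonal_2[OF e(2)]) (simp add: conn_21_def mult.assoc)
qed

end

end

section \<open>The connection form\<close>

lemma rmul_rmul: "\<omega> \<cdot>\<^sub>r a \<cdot>\<^sub>r b = \<omega> \<cdot>\<^sub>r (a * b)"
  by (cases \<omega> rule: prod.exhaust) (auto simp: rmul_def form_map_def map_prod_def mult.assoc)

lemma rmul_add: "\<omega> \<cdot>\<^sub>r (a + b) = \<omega> \<cdot>\<^sub>r a + \<omega> \<cdot>\<^sub>r b"
  by (auto simp: rmul_def form_map_def map_prod_def distrib_left split: prod.splits)

lemma rmul_scaleR: "\<omega> \<cdot>\<^sub>r (r *\<^sub>R a) = r *\<^sub>R (\<omega> \<cdot>\<^sub>r a)"
  by (auto simp: rmul_def form_map_def map_prod_def split: prod.splits)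

lemma rmul_1: "\<omega> \<cdot>\<^sub>r 1 = \<omega>"
  by (auto simp: rmul_def form_map_def map_prod_def split: prod.splits)

lemma rmul_0: "\<omega> \<cdot>\<^sub>r 0 = 0"
  by (auto simp: rmul_def form_map_def map_prod_def zero_prod_def split: prod.splits)

context quantum_su3
begin

section \<open>Uniqueness of the matrix of one-forms\<close>

lemma rmul_z_cancel:
  assumes "\<And>k. \<omega> \<cdot>\<^sub>r u I3 k = \<omega>' \<cdot>\<^sub>r u I3 k"
  shows "\<omega> = \<omega>'"
proof -
  have "\<omega> \<cdot>\<^sub>r (u I3 k * adj (u I3 k)) = \<omega>' \<cdot>\<^sub>r (u I3 k * adj (u I3 k))" for k
    using assms[of k] by (simp flip: rmul_rmul)
  then have "\<omega> \<cdot>\<^sub>r (z1 * adj z1 + z2 * adj z2 + z3 * adj z3) = \<omega>' \<cdot>\<^sub>r (z1 * adj z1 + z2 * adj z2 + z3 * adj z3)"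
    by (simp add: rmul_add)
  then show ?thesis by (simp add: sum_z_adj[OF q_nonzero] rmul_1)
qed

lemma rmul_zs_cancel:
  assumes "\<And>k. \<omega> \<cdot>\<^sub>r adj (u I3 k) = \<omega>' \<cdot>\<^sub>r adj (u I3 k)"
  shows "\<omega> = \<omega>'"
proof -
  have "\<omega> \<cdot>\<^sub>r (adj (u I3 k) * u I3 k) = \<omega>' \<cdot>\<^sub>r (adj (u I3 k) * u I3 k)" for k
    using assms[of k] by (simp flip: rmul_rmul)
  then have "\<omega> \<cdot>\<^sub>r (q ^ 4 *\<^sub>R (adj z1 * z1) + q\<^sup>2 *\<^sub>R (adj z2 * z2) + adj z3 * z3)
      = \<omega>' \<cdot>\<^sub>r (q ^ 4 *\<^sub>R (adj z1 * z1) + q\<^sup>2 *\<^sub>R (adj z2 * z2) + adj z3 * z3)"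
    by (simp add: rmul_add rmul_scaleR)
  then show ?thesis by (simp add: weighted_sum_adj_z[OF q_nonzero] rmul_1)
qed

lemma matrix_act_eqD:
  fixes \<omega> \<omega>' :: "'c form ^ 2 ^ 2"
  assumes "\<And>\<eta>. \<eta> $ 1 \<in> line_bundle q t u act 1 \<Longrightarrow> \<eta> $ 2 \<in> line_bundle q t u act (-1)
             \<Longrightarrow> matrix_act \<omega> \<eta> = matrix_act \<omega>' \<eta>"
  shows "\<omega> = \<omega>'"
proof -
  have 0: "0 \<in> line_bundle q t u act N" for N
    by (simp add: line_bundle_def alg_0)
  have 1: "\<omega> $ i $ 1 = \<omega>' $ i $ 1" for i
  proof (rule rmul_z_cancel)
    fix k
    have "matrix_act \<omega> (vector [u I3 k, 0]) = matrix_act \<omega>' (vector [u I3 k, 0])"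
      by (rule assms) (simp_all add: z_line_bundle 0)
    from arg_cong[OF this, of "\<lambda>v. v $ i"]
    show "\<omega> $ i $ 1 \<cdot>\<^sub>r u I3 k = \<omega>' $ i $ 1 \<cdot>\<^sub>r u I3 k"
      by (simp add: matrix_act_def sum_2 rmul_0)
  qed
  have 2: "\<omega> $ i $ 2 = \<omega>' $ i $ 2" for i
  proof (rule rmul_zs_cancel)
    fix k
    have "matrix_act \<omega> (vector [0, adj (u I3 k)]) = matrix_act \<omega>' (vector [0, adj (u I3 k)])"
      by (rule assms) (simp_all add: z_line_bundle 0)
    from arg_cong[OF this, of "\<lambda>v. v $ i"]
    show "\<omega> $ i $ 2 \<cdot>\<^sub>r adj (u I3 k) = \<omega>' $ i $ 2 \<cdot>\<^sub>r adj (u I3 k)"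
      by (simp add: matrix_act_def sum_2 rmul_0)
  qed
  show ?thesis
    using 1 2 by (simp add: vec_eq_iff forall_2)
qed

definition \<Omega> :: "'c form ^ 2 ^ 2" where
  "\<Omega> = vector [vector [fo conn_11, fo conn_12], vector [fo conn_21, fo conn_22]]"

lemma matrix_act_Omega:
  "matrix_act \<Omega> \<eta> = vector [fo (\<lambda>d. conn_11 d * \<eta> $ 1 + conn_12 d * \<eta> $ 2), fo (\<lambda>d. conn_21 d * \<eta> $ 1 + conn_22 d * \<eta> $ 2)]"
  by (simp add: vec_eq_iff forall_2 matrix_act_def sum_2 \<Omega>_def form_of_rmul form_of_add)

lemma nabla_Omega:
  assumes "t = sin (2 * \<theta>)" "\<eta> $ 1 \<in> line_bundle q t u act 1" "\<eta> $ 2 \<in> line_bundle q t u act (-1)"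
  shows "nabla_tilde q \<theta> t u act \<eta> = nabla_0 q u act \<eta> + matrix_act \<Omega> \<eta>"
proof -
  have e: "wt sq (\<eta> $ 1)" "wt (1 / sq) (\<eta> $ 2)"
    using line_bundle_wt[OF assms(2)] line_bundle_wt[OF assms(3)] sq(4) by (simp_all add: sq_def)
  let ?psi = "psi_col \<theta> u" and ?phi = "phi_col q \<theta> u"
  let ?w = "\<lambda>cs k d. \<Sum>(c, a, b)\<leftarrow>zip cs (zip ?psi ?phi).
           adj (c * k) * D d (a * f0 * \<eta> $ 1 + b * f4 * \<eta> $ 2)"
  have tilde: "nabla_tilde q \<theta> t u act \<eta> $ 1 = fo (?w ?psi f0)"
    "nabla_tilde q \<theta> t u act \<eta> $ 2 = fo (?w ?phi f4)"
    by (simp_all add: nabla_tilde_def grassmann_def sum_2 dd_form_of form_of_lmul form_of_add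
        Psi_tilde_def psi_col_def phi_col_def xinv_def)
  have "nabla_0 q u act \<eta> $ 1 = fo (\<lambda>d. \<Sum>a\<leftarrow>Psi_1 u. adj a * D d (a * \<eta> $ 1))"
    "nabla_0 q u act \<eta> $ 2 = fo (\<lambda>d. \<Sum>a\<leftarrow>Psi_m1 q u. adj a * D d (a * \<eta> $ 2))"
    by (simp_all add: nabla_0_def grassmann_line_def dd_form_of form_of_lmul form_of_sum_list)
  then show ?thesis
    by (simp add: vec_eq_iff forall_2 tilde matrix_act_Omega grassmann_row_1[OF assms(1) e] grassmann_row_2[OF assms(1) e]
        form_of_add)
qed

section \<open>Comparison of the entries with the closed formulas\<close>

lemma D_xinv_adj: "star_coeff q d *\<^sub>R adj (D (opp d) (xinv k)) = D d (xinv k)"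
  using D_adj[of "xinv k" d] wt_alg[OF wt_roots(1)[of k]] by (simp add: adj_roots)

lemma D_zs_adj: "star_coeff q d *\<^sub>R adj (D (opp d) (u I3 k)) = D d (adj (u I3 k))"
  by (simp add: D_adj alg_u)

lemma D_p:
  assumes "holo d" shows "D d (pp u j k) = sq *\<^sub>R (adj (u I3 j) * D d (u I3 k))"
  using assms sq by (simp add: pp_def zz_def D_mult[OF wt_zs wt_z] D_zs)

lemma Omega_11:
  "q *\<^sub>R (xr 0 (1/2) \<cdot>\<^sub>l del_form q act (xr 0 (-1/2)))
     - form_star q (q *\<^sub>R (xr 0 (1/2) \<cdot>\<^sub>l del_form q act (xr 0 (-1/2)))) = fo conn_11"
proof -
  have "star_coeff q d *\<^sub>R adj (q *\<^sub>R (h0 * D (opp d) f0)) = q *\<^sub>R (D d f0 * h0)" for d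
    by (simp add: adj_mult adj_scaleR adj_roots D_xinv_adj[of d 0, symmetric] mult.commute)
  then show ?thesis
    unfolding xsqrt_def[symmetric] xinv_def[symmetric] del_form_of form_of_lmul form_of_scaleR
      form_of_star[OF q_pos] form_of_diff
    by (intro arg_cong[of _ _ fo]) (auto simp: conn_11_def fun_eq_iff)
qed

lemma Omega_22:
  "(1 / q) *\<^sub>R (xr 4 (1/2) \<cdot>\<^sub>l delbar_form act (xr 4 (-1/2)))
     - form_star q ((1 / q) *\<^sub>R (xr 4 (1/2) \<cdot>\<^sub>l delbar_form act (xr 4 (-1/2)))) = fo conn_22"
proof -
  have "star_coeff q d *\<^sub>R adj ((1 / q) *\<^sub>R (h4 * D (opp d) f4)) = (1 / q) *\<^sub>R (D d f4 * h4)" for d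
    by (simp add: adj_mult adj_scaleR adj_roots D_xinv_adj[of d 4, symmetric] mult.commute)
  then show ?thesis
    unfolding xsqrt_def[symmetric] xinv_def[symmetric] delbar_form_of form_of_lmul form_of_scaleR
      form_of_star[OF q_pos] form_of_diff
    by (intro arg_cong[of _ _ fo]) (auto simp: conn_22_def fun_eq_iff)
qed

text \<open>For type (1,0) the sum of \<open>z_j * D d (pp u j k)\<close> over j collapses to
  \<open>sq *\<^sub>R D d (u I3 k)\<close> by the sphere relation. The prefactor of
  \<open>\<phi>\<close> is another \<open>sq\<close>, and \<open>D_z_commute\<close> then moves the
  derivatives to the right.\<close>

lemma Omega_12:
  "(q powr (-1/2) * t) *\<^sub>R (xr 0 (-1/2) \<cdot>\<^sub>l
      (q powr (1/2) *\<^sub>R (\<Sum>j\<in>UNIV. zz u j \<cdot>\<^sub>l del_form q act (pp u j I2) \<cdot>\<^sub>r zz u I3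
           - q *\<^sub>R (zz u j \<cdot>\<^sub>l del_form q act (pp u j I3) \<cdot>\<^sub>r zz u I2))) \<cdot>\<^sub>r xr 4 (-1/2)) = fo conn_12"
proof -
  have collect: "z1 * (adj z1 * a) + z2 * (adj z2 * a) + z3 * (adj z3 * a) = a" for a
    by (simp add: sum_z_adj[OF q_nonzero] flip: mult.assoc distrib_right)
  have "sq *\<^sub>R (\<Sum>j\<in>UNIV. zz u j * (if holo d then D d (pp u j I2) else 0) * zz u I3
           - q *\<^sub>R (zz u j * (if holo d then D d (pp u j I3) else 0) * zz u I2))
      = q *\<^sub>R (z3 * D d z2) - z2 * D d z3" for d
  proof (cases "holo d")
    case True
    have "(\<Sum>j\<in>UNIV. zz u j * D d (pp u j k)) = sq *\<^sub>R D d (u I3 k)" for k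
      using collect[of "D d (u I3 k)"]
      by (simp add: UNIV_ind D_p[OF True] zz_def add.assoc flip: scaleR_add_right)
    then have "sq *\<^sub>R (\<Sum>j\<in>UNIV. zz u j * D d (pp u j I2) * zz u I3 - q *\<^sub>R (zz u j * D d (pp u j I3) * zz u I2))
      = q *\<^sub>R (D d z2 * z3) - q\<^sup>2 *\<^sub>R (D d z3 * z2)"
      by (simp add: sum_subtractf sum_distrib_right[symmetric] scaleR_sum_right[symmetric] zz_def
          scaleR_diff_right mult.left_commute[of sq] sq(2) power2_eq_square)
    also have "\<dots> = q *\<^sub>R (z3 * D d z2) - z2 * D d z3"
      using D_z_commute[of d] by (simp add: algebra_simps)
    finally show ?thesis
      using True by simp
  qed (simp add: D_z)
  then have "(\<lambda>d. (1 / sq * t) *\<^sub>R (f0 * (sq *\<^sub>R (\<Sum>j\<in>UNIV. zz u j * (if holo d then D d (pp u j I2) else 0) * zz u I3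
           - q *\<^sub>R (zz u j * (if holo d then D d (pp u j I3) else 0) * zz u I2))) * f4)) = conn_12"
    by (simp add: conn_12_def fun_eq_iff del: mult_scaleR_right mult_scaleR_left)
  then show ?thesis
    unfolding xinv_def[symmetric] sq_def[symmetric] sq(4) del_form_of form_of_lmul form_of_rmul
      form_of_scaleR form_of_diff form_of_sum
    by simp
qed

text \<open>The adjoint has its derivatives on the left. Moving them to the right by
  \<open>D_zs_commute\<close> costs a factor \<open>-q\<close>, which turns \<open>t / sq\<close>
  into \<open>sq * t\<close> and accounts for the sign.\<close>

lemma Omega_21: "- form_star q (fo conn_12) = fo conn_21"
proof -
  have "- (star_coeff q d *\<^sub>R adj (conn_12 (opp d))) = conn_21 d" for d
  proof -
    have "star_coeff q d *\<^sub>R adj (conn_12 (opp d))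
       = (t / sq) *\<^sub>R (f4 * (q *\<^sub>R (D d (adj z2) * adj z3) - D d (adj z3) * adj z2) * f0)"
      unfolding conn_12_def D_zs_adj[symmetric]
      by (simp add: adj_mult adj_scaleR adj_diff adj_roots mult.assoc algebra_simps)
    also have "q *\<^sub>R (D d (adj z2) * adj z3) - D d (adj z3) * adj z2
       = - (q *\<^sub>R ((1 / q) *\<^sub>R (D d (adj z3) * adj z2) - D d (adj z2) * adj z3))"
      using q_nonzero by (simp add: scaleR_diff_right)
    also have "\<dots> = - (q *\<^sub>R (q *\<^sub>R (adj z2 * D d (adj z3)) - adj z3 * D d (adj z2)))"
      by (simp only: D_zs_commute)
    finally have "star_coeff q d *\<^sub>R adj (conn_12 (opp d))
       = - ((t / sq * q) *\<^sub>R (f4 * (q *\<^sub>R (adj z2 * D d (adj z3)) - adj z3 * D d (adj z2)) * f0))"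
      by simp
    moreover have "t / sq * q = sq * t"
      using sq(1,2) by (simp add: field_simps)
    ultimately show ?thesis by (simp add: conn_21_def)
  qed
  then show ?thesis
    unfolding form_of_star[OF q_pos] form_of_minus by simp
qed

end

theorem proposition4p7:
  fixes q \<theta> t :: real
    and u :: "ind \<Rightarrow> ind \<Rightarrow> 'c::cstar_algebra"
    and act :: "ugen falg \<Rightarrow> 'c \<Rightarrow> 'c"
    and \<omega> :: "'c form ^ 2 ^ 2"
  assumes "0 < q" and "q < 1"
    and "0 \<le> \<theta>" and "\<theta> < pi / 4" and "t = sin (2 * \<theta>)"
    and "universal_SUq3 q u"
    and "Uq_action q u t act"
  shows "(\<forall>\<eta> :: 'c ^ 2.
            \<eta> $ 1 \<in> line_bundle q t u act 1 \<and> \<eta> $ 2 \<in> line_bundle q t u act (-1) \<longrightarrow>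
            nabla_tilde q \<theta> t u act \<eta> = nabla_0 q u act \<eta> + matrix_act \<omega> \<eta>)
     \<longleftrightarrow>
     (let Astar = q *\<^sub>R (xroot q t u 0 (1/2) \<cdot>\<^sub>l del_form q act (xroot q t u 0 (-1/2)));
          A = form_star q Astar;
          B = (1 / q) *\<^sub>R (xroot q t u 4 (1/2) \<cdot>\<^sub>l delbar_form act (xroot q t u 4 (-1/2)));
          \<phi> = q powr (1/2) *\<^sub>R
                (\<Sum>j\<in>UNIV. zz u j \<cdot>\<^sub>l del_form q act (pp u j I2) \<cdot>\<^sub>r zz u I3
                        - q *\<^sub>R (zz u j \<cdot>\<^sub>l del_form q act (pp u j I3) \<cdot>\<^sub>r zz u I2));
          \<Phi> = (q powr (-1/2) * t) *\<^sub>R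
                (xroot q t u 0 (-1/2) \<cdot>\<^sub>l \<phi> \<cdot>\<^sub>r xroot q t u 4 (-1/2))
      in \<omega> = vector [vector [Astar - A, \<Phi>],
                     vector [- form_star q \<Phi>, B - form_star q B]])"
proof -
  have "0 \<le> t" "t < 1"
  proof -
    \<comment> \<open>The bound \<open>\<theta> < pi / 4\<close> enters here; \<open>t < 1\<close>
      makes the power series of the roots converge.\<close>
    have "sin (2 * \<theta>) < sin (pi / 2)"
      using assms by (intro sin_monotone_2pi) (auto intro: pi_gt_zero order_less_le_trans[of _ 0])
    then show "t < 1" using assms by simp
    show "0 \<le> t" using assms by (auto intro!: sin_ge_zero)
  qed
  with assms interpret quantum_su3 q u t act
    by (simp add: quantum_su3_def quantum_su3_axioms_def)
  have "(\<forall>\<eta> :: 'c ^ 2.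
            \<eta> $ 1 \<in> line_bundle q t u act 1 \<and> \<eta> $ 2 \<in> line_bundle q t u act (-1) \<longrightarrow>
            nabla_tilde q \<theta> t u act \<eta> = nabla_0 q u act \<eta> + matrix_act \<omega> \<eta>) \<longleftrightarrow> \<omega> = \<Omega>"
    (is "?L \<longleftrightarrow> _")
  proof
    assume ?L
    then show "\<omega> = \<Omega>"
      using nabla_Omega[OF assms(5)] by (intro matrix_act_eqD) (metis add_left_cancel)
  qed (use nabla_Omega[OF assms(5)] in blast)
  then show ?thesis
    unfolding Let_def Omega_11 Omega_22 Omega_12 Omega_21 \<Omega>_def .
qed

end
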